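(* Let $\mathbb F_\infty$ be the free group on infinitely many generators $z_1,z_2,\dots$ and let $\mathbb F_\infty^+$ be the subsemigroup (with identity) generated by the $z_i$. A bicovariant partial isometric representation $S$ of $\mathbb F_\infty^+$ is universal if and only if $S_\mu\neq0$ for every $\mu\in\mathbb F_\infty^+$.
   Context: A partial isometric representation of $P=\mathbb F_\infty^+$ is a semigroup homomorphism $S:P\to B$ into a $C^*$-algebra $B$ (under multiplication) such that each $S_\mu$ is a partial isometry. Let $G=\mathbb F_\infty$. The left-invariant order on $G$ is $\mu\le_l\nu\iff\mu^{-1}\nu\in P$ and the right-invariant order is $\mu\le_r\nu\iff\nu\mu^{-1}\in P$. For both orders, any $\mu,\nu\in P$ with a common upper bound in $P$ have a least upper bound in $P$, denoted $\mu\vee_l\nu$ and $\mu\vee_r\nu$ respectively; write $\infty$ when there is no common upper bound. $S$ is bicovariant if for all $\mu,\nu\in P$: $S_\mu S_\mu^*S_\nu S_\nu^*=S_{\mu\vee_l\nu}S_{\mu\vee_l\nu}^*$ if $\mu\vee_l\nu<\infty$ and $0$ otherwise; and $S_\mu^*S_\mu S_\nu^*S_\nu=S_{\mu\vee_r\nu}^*S_{\mu\vee_r\nu}$ if $\mu\vee_r\nu<\infty$ and $0$ otherwise. A bicovariant partial isometric representation $S$ is universal if, for every bicovariant partial isometric representation $W$ of $\mathbb F_\infty^+$, there is a homomorphism of $C^*\{S_\mu:\mu\in\mathbb F_\infty^+\}$ which maps $S_\mu$ to $W_\mu$ for each $\mu$. *)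

theory Defs
  imports Complex_Main "HOL-Library.Equipollence" "HOL-Algebra.Ring"
begin

section \<open>The free group on countably many generators and its positive cone\<close>

text \<open>A letter (i, b) is the generator with index i if b is False, and its formal inverse if b is
  True. Elements of the free group are the reduced words in these letters.\<close>

type_synonym letter = "nat \<times> bool"
type_synonym word = "letter list"

definition inv_letter :: "letter \<Rightarrow> letter" where
  "inv_letter a = (fst a, \<not> snd a)"

definition reduced :: "word \<Rightarrow> bool" where
  "reduced w \<longleftrightarrow> successively (\<lambda>a b. b \<noteq> inv_letter a) w"

fun cancel_cons :: "letter \<Rightarrow> word \<Rightarrow> word" where
  "cancel_cons a [] = [a]"
| "cancel_cons a (b # w) = (if b = inv_letter a then w else a # b # w)"

definition word_mult :: "word \<Rightarrow> word \<Rightarrow> word" where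
  "word_mult u v = foldr cancel_cons u v"

definition free_group_inf :: "word monoid" (\<open>\<F>\<^sub>\<infinity>\<close>) where
  "\<F>\<^sub>\<infinity> = \<lparr>carrier = {w. reduced w}, mult = word_mult, one = []\<rparr>"

definition gen :: "nat \<Rightarrow> word" where
  "gen i = [(i, False)]"

inductive_set free_semigroup_inf :: "word set" (\<open>\<F>\<^sub>\<infinity>\<^sup>+\<close>) where
  one: "\<one>\<^bsub>\<F>\<^sub>\<infinity>\<^esub> \<in> \<F>\<^sub>\<infinity>\<^sup>+"
| gen: "gen i \<in> \<F>\<^sub>\<infinity>\<^sup>+"
| mult: "\<mu> \<in> \<F>\<^sub>\<infinity>\<^sup>+ \<Longrightarrow> \<nu> \<in> \<F>\<^sub>\<infinity>\<^sup>+ \<Longrightarrow> \<mu> \<otimes>\<^bsub>\<F>\<^sub>\<infinity>\<^esub> \<nu> \<in> \<F>\<^sub>\<infinity>\<^sup>+"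

definition le_l :: "word \<Rightarrow> word \<Rightarrow> bool" where
  "le_l \<mu> \<nu> \<longleftrightarrow> inv\<^bsub>\<F>\<^sub>\<infinity>\<^esub> \<mu> \<otimes>\<^bsub>\<F>\<^sub>\<infinity>\<^esub> \<nu> \<in> \<F>\<^sub>\<infinity>\<^sup>+"

definition le_r :: "word \<Rightarrow> word \<Rightarrow> bool" where
  "le_r \<mu> \<nu> \<longleftrightarrow> \<nu> \<otimes>\<^bsub>\<F>\<^sub>\<infinity>\<^esub> inv\<^bsub>\<F>\<^sub>\<infinity>\<^esub> \<mu> \<in> \<F>\<^sub>\<infinity>\<^sup>+"

definition is_upper_bound :: "(word \<Rightarrow> word \<Rightarrow> bool) \<Rightarrow> word \<Rightarrow> word \<Rightarrow> word \<Rightarrow> bool" where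
  "is_upper_bound rel \<mu> \<nu> \<kappa> \<longleftrightarrow> \<kappa> \<in> \<F>\<^sub>\<infinity>\<^sup>+ \<and> rel \<mu> \<kappa> \<and> rel \<nu> \<kappa>"

definition is_join :: "(word \<Rightarrow> word \<Rightarrow> bool) \<Rightarrow> word \<Rightarrow> word \<Rightarrow> word \<Rightarrow> bool" where
  "is_join rel \<mu> \<nu> \<kappa> \<longleftrightarrow>
     is_upper_bound rel \<mu> \<nu> \<kappa> \<and> (\<forall>\<kappa>'. is_upper_bound rel \<mu> \<nu> \<kappa>' \<longrightarrow> rel \<kappa> \<kappa>')"

text \<open>None stands for infinity, i.e. the absence of a common upper bound in the positive cone.
  On the positive cone, the least upper bounds selected here exist and are unique; see
  \<open>join_l_eq_Some_iff\<close> and \<open>join_r_eq_Some_iff\<close>.\<close>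

definition word_join :: "(word \<Rightarrow> word \<Rightarrow> bool) \<Rightarrow> word \<Rightarrow> word \<Rightarrow> word option" where
  "word_join rel \<mu> \<nu> =
     (if \<exists>\<kappa>. is_upper_bound rel \<mu> \<nu> \<kappa> then Some (THE \<kappa>. is_join rel \<mu> \<nu> \<kappa>) else None)"

abbreviation join_l :: "word \<Rightarrow> word \<Rightarrow> word option" where
  "join_l \<equiv> word_join le_l"

abbreviation join_r :: "word \<Rightarrow> word \<Rightarrow> word option" where
  "join_r \<equiv> word_join le_r"


subsection \<open>Basic facts\<close>

lemma inv_letter_inv_letter [simp]: "inv_letter (inv_letter a) = a"
  by (simp add: inv_letter_def)

lemma inv_letter_neq [simp]: "inv_letter a \<noteq> a" "a \<noteq> inv_letter a"
  by (auto simp: inv_letter_def prod_eq_iff)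

lemma reduced_Nil [simp]: "reduced []"
  by (simp add: reduced_def)

lemma reduced_Cons: "reduced (a # w) \<longleftrightarrow> (w = [] \<or> hd w \<noteq> inv_letter a) \<and> reduced w"
  by (auto simp: reduced_def successively_Cons)

lemma reduced_cancel_cons: "reduced w \<Longrightarrow> reduced (cancel_cons a w)"
  by (cases w) (auto simp: reduced_Cons)

lemma cancel_cons_cancel_cons:
  "reduced w \<Longrightarrow> cancel_cons a (cancel_cons (inv_letter a) w) = w"
  by (cases w; cases "tl w") (auto simp: reduced_Cons)

lemma reduced_word_mult: "reduced v \<Longrightarrow> reduced (word_mult u v)"
  by (induction u) (auto simp: word_mult_def reduced_cancel_cons)

lemma word_mult_cancel_cons:
  assumes "reduced w"
  shows "word_mult (cancel_cons a v) w = cancel_cons a (word_mult v w)"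
proof (cases v)
  case Nil
  then show ?thesis by (simp add: word_mult_def)
next
  case (Cons b v')
  then show ?thesis
    using cancel_cons_cancel_cons[OF reduced_word_mult[OF assms, of v'], of a]
    by (auto simp: word_mult_def)
qed

lemma word_mult_assoc:
  "reduced w \<Longrightarrow> word_mult (word_mult u v) w = word_mult u (word_mult v w)"
proof (induction u)
  case Nil
  then show ?case by (simp add: word_mult_def)
next
  case (Cons a u)
  have "word_mult (word_mult (a # u) v) w = word_mult (cancel_cons a (word_mult u v)) w"
    by (simp add: word_mult_def)
  also have "\<dots> = cancel_cons a (word_mult u (word_mult v w))"
    using Cons by (simp add: word_mult_cancel_cons)
  finally show ?case by (simp add: word_mult_def)
qed

lemma word_mult_Nil_right: "reduced u \<Longrightarrow> word_mult u [] = u"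
proof (induction u)
  case Nil
  then show ?case by (simp add: word_mult_def)
next
  case (Cons a u)
  then have "word_mult (a # u) [] = cancel_cons a u"
    by (simp add: word_mult_def reduced_Cons)
  then show ?case
    using Cons.prems by (cases u) (auto simp: reduced_Cons)
qed

lemma word_mult_left_inverse: "word_mult (rev (map inv_letter u)) u = []"
  by (induction u) (auto simp: word_mult_def)

lemma reduced_inverse: "reduced u \<Longrightarrow> reduced (rev (map inv_letter u))"
  unfolding reduced_def
  by (auto simp: successively_map elim!: successively_mono)

lemma group_free_group_inf: "group \<F>\<^sub>\<infinity>"
proof (rule groupI)
  fix x assume "x \<in> carrier \<F>\<^sub>\<infinity>"
  then show "\<exists>y\<in>carrier \<F>\<^sub>\<infinity>. y \<otimes>\<^bsub>\<F>\<^sub>\<infinity>\<^esub> x = \<one>\<^bsub>\<F>\<^sub>\<infinity>\<^esub>"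
    by (intro bexI[of _ "rev (map inv_letter x)"])
       (auto simp: free_group_inf_def word_mult_left_inverse reduced_inverse)
qed (auto simp: free_group_inf_def reduced_word_mult word_mult_assoc, simp add: word_mult_def)

definition pos_word :: "nat list \<Rightarrow> word" where
  "pos_word xs = map (\<lambda>i. (i, False)) xs"

lemma inj_pos_word: "pos_word xs = pos_word ys \<longleftrightarrow> xs = ys"
  by (auto simp: pos_word_def inj_on_def dest!: map_injective)

lemma reduced_pos_word: "reduced (pos_word xs)"
  by (induction xs) (auto simp: pos_word_def reduced_Cons inv_letter_def hd_map)

lemma pos_word_in_carrier: "pos_word xs \<in> carrier \<F>\<^sub>\<infinity>"
  by (simp add: free_group_inf_def reduced_pos_word)

lemma mult_pos_word: "pos_word xs \<otimes>\<^bsub>\<F>\<^sub>\<infinity>\<^esub> pos_word ys = pos_word (xs @ ys)"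
proof (induction xs)
  case Nil
  then show ?case by (simp add: free_group_inf_def word_mult_def pos_word_def)
next
  case (Cons i xs)
  then have "pos_word (i # xs) \<otimes>\<^bsub>\<F>\<^sub>\<infinity>\<^esub> pos_word ys = cancel_cons (i, False) (pos_word (xs @ ys))"
    by (simp add: free_group_inf_def word_mult_def pos_word_def)
  also have "\<dots> = pos_word ((i # xs) @ ys)"
    by (cases "xs @ ys") (auto simp: pos_word_def inv_letter_def)
  finally show ?case .
qed

lemma free_semigroup_inf_eq: "\<F>\<^sub>\<infinity>\<^sup>+ = range pos_word"
proof (intro equalityI subsetI)
  fix \<mu> assume "\<mu> \<in> \<F>\<^sub>\<infinity>\<^sup>+"
  then show "\<mu> \<in> range pos_word"
  proof induction
    case one
    show ?case by (rule image_eqI[of _ _ "[]"]) (auto simp: free_group_inf_def pos_word_def)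
  next
    case (gen i)
    show ?case by (rule image_eqI[of _ _ "[i]"]) (auto simp: gen_def pos_word_def)
  next
    case (mult \<mu> \<nu>)
    then show ?case by (auto simp: mult_pos_word)
  qed
next
  fix \<mu> assume "\<mu> \<in> range pos_word"
  then obtain xs where "\<mu> = pos_word xs" by auto
  moreover have "pos_word xs \<in> \<F>\<^sub>\<infinity>\<^sup>+"
  proof (induction xs)
    case Nil
    show ?case using free_semigroup_inf.one by (simp add: free_group_inf_def pos_word_def)
  next
    case (Cons i xs)
    have "pos_word (i # xs) = gen i \<otimes>\<^bsub>\<F>\<^sub>\<infinity>\<^esub> pos_word xs"
      using mult_pos_word[of "[i]" xs] by (simp add: gen_def pos_word_def)
    then show ?case using Cons by (auto intro: free_semigroup_inf.intros)
  qed
  ultimately show "\<mu> \<in> \<F>\<^sub>\<infinity>\<^sup>+" by simp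
qed

lemma le_l_pos_word: "le_l (pos_word xs) (pos_word ys) \<longleftrightarrow> (\<exists>zs. ys = xs @ zs)"
proof -
  interpret group "\<F>\<^sub>\<infinity>" by (rule group_free_group_inf)
  have "inv\<^bsub>\<F>\<^sub>\<infinity>\<^esub> pos_word xs \<otimes>\<^bsub>\<F>\<^sub>\<infinity>\<^esub> pos_word ys = pos_word zs \<longleftrightarrow> ys = xs @ zs" for zs
    using inv_solve_left[of "pos_word zs" "pos_word xs" "pos_word ys"]
    by (auto simp: pos_word_in_carrier mult_pos_word inj_pos_word)
  then show ?thesis
    unfolding le_l_def free_semigroup_inf_eq by (auto simp: image_iff)
qed

lemma le_r_pos_word: "le_r (pos_word xs) (pos_word ys) \<longleftrightarrow> (\<exists>zs. ys = zs @ xs)"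
proof -
  interpret group "\<F>\<^sub>\<infinity>" by (rule group_free_group_inf)
  have "pos_word ys \<otimes>\<^bsub>\<F>\<^sub>\<infinity>\<^esub> inv\<^bsub>\<F>\<^sub>\<infinity>\<^esub> pos_word xs = pos_word zs \<longleftrightarrow> ys = zs @ xs" for zs
    using inv_solve_right[of "pos_word zs" "pos_word ys" "pos_word xs"]
    by (auto simp: pos_word_in_carrier mult_pos_word inj_pos_word)
  then show ?thesis
    unfolding le_r_def free_semigroup_inf_eq by (auto simp: image_iff)
qed

lemma join_eq_Some_iff_aux:
  assumes ex: "\<And>\<kappa>. is_upper_bound rel \<mu> \<nu> \<kappa> \<Longrightarrow> \<exists>\<kappa>. is_join rel \<mu> \<nu> \<kappa>"
    and antisym: "\<And>\<alpha> \<beta>. \<alpha> \<in> \<F>\<^sub>\<infinity>\<^sup>+ \<Longrightarrow> \<beta> \<in> \<F>\<^sub>\<infinity>\<^sup>+ \<Longrightarrow> rel \<alpha> \<beta> \<Longrightarrow> rel \<beta> \<alpha> \<Longrightarrow> \<alpha> = \<beta>"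
  shows "word_join rel \<mu> \<nu> = Some \<kappa> \<longleftrightarrow> is_join rel \<mu> \<nu> \<kappa>"
proof -
  have uniq: "\<alpha> = \<beta>" if "is_join rel \<mu> \<nu> \<alpha>" "is_join rel \<mu> \<nu> \<beta>" for \<alpha> \<beta>
    using that antisym unfolding is_join_def is_upper_bound_def by blast
  then have the: "(THE \<kappa>. is_join rel \<mu> \<nu> \<kappa>) = \<alpha>" if "is_join rel \<mu> \<nu> \<alpha>" for \<alpha>
    using that by blast
  show ?thesis
  proof
    assume "word_join rel \<mu> \<nu> = Some \<kappa>"
    then have "\<exists>\<kappa>. is_upper_bound rel \<mu> \<nu> \<kappa>" and k: "\<kappa> = (THE \<kappa>. is_join rel \<mu> \<nu> \<kappa>)"
      by (auto simp: word_join_def split: if_splits)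
    then obtain \<alpha> where "is_join rel \<mu> \<nu> \<alpha>" using ex by blast
    then show "is_join rel \<mu> \<nu> \<kappa>" using the k by auto
  next
    assume "is_join rel \<mu> \<nu> \<kappa>"
    then show "word_join rel \<mu> \<nu> = Some \<kappa>"
      using the by (auto simp: word_join_def is_join_def)
  qed
qed

lemma join_l_eq_Some_iff:
  assumes "\<mu> \<in> \<F>\<^sub>\<infinity>\<^sup>+" "\<nu> \<in> \<F>\<^sub>\<infinity>\<^sup>+"
  shows "join_l \<mu> \<nu> = Some \<kappa> \<longleftrightarrow> is_join le_l \<mu> \<nu> \<kappa>"
proof (rule join_eq_Some_iff_aux)
  fix \<kappa> assume ub: "is_upper_bound le_l \<mu> \<nu> \<kappa>"
  obtain xs ys zs where eq: "\<mu> = pos_word xs" "\<nu> = pos_word ys" "\<kappa> = pos_word zs"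
    using assms ub by (auto simp: is_upper_bound_def free_semigroup_inf_eq)
  obtain us vs where "xs @ us = ys @ vs"
    using ub by (metis eq is_upper_bound_def le_l_pos_word)
  then consider "\<exists>ws. xs = ys @ ws" | "\<exists>ws. ys = xs @ ws"
    by (auto simp: append_eq_append_conv2)
  then show "\<exists>\<kappa>. is_join le_l \<mu> \<nu> \<kappa>"
  proof cases
    case 1
    then have "is_join le_l \<mu> \<nu> \<mu>"
      using assms eq by (auto simp: is_join_def is_upper_bound_def le_l_pos_word)
    then show ?thesis ..
  next
    case 2
    then have "is_join le_l \<mu> \<nu> \<nu>"
      using assms eq by (auto simp: is_join_def is_upper_bound_def le_l_pos_word)
    then show ?thesis ..
  qed
qed (auto simp: free_semigroup_inf_eq le_l_pos_word)

lemma join_r_eq_Some_iff: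
  assumes "\<mu> \<in> \<F>\<^sub>\<infinity>\<^sup>+" "\<nu> \<in> \<F>\<^sub>\<infinity>\<^sup>+"
  shows "join_r \<mu> \<nu> = Some \<kappa> \<longleftrightarrow> is_join le_r \<mu> \<nu> \<kappa>"
proof (rule join_eq_Some_iff_aux)
  fix \<kappa> assume ub: "is_upper_bound le_r \<mu> \<nu> \<kappa>"
  obtain xs ys zs where eq: "\<mu> = pos_word xs" "\<nu> = pos_word ys" "\<kappa> = pos_word zs"
    using assms ub by (auto simp: is_upper_bound_def free_semigroup_inf_eq)
  obtain us vs where "us @ xs = vs @ ys"
    using ub by (metis eq is_upper_bound_def le_r_pos_word)
  then consider "\<exists>ws. xs = ws @ ys" | "\<exists>ws. ys = ws @ xs"
    by (auto simp: append_eq_append_conv2)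
  then show "\<exists>\<kappa>. is_join le_r \<mu> \<nu> \<kappa>"
  proof cases
    case 1
    then have "is_join le_r \<mu> \<nu> \<mu>"
      using assms eq by (auto simp: is_join_def is_upper_bound_def le_r_pos_word)
    then show ?thesis ..
  next
    case 2
    then have "is_join le_r \<mu> \<nu> \<nu>"
      using assms eq by (auto simp: is_join_def is_upper_bound_def le_r_pos_word)
    then show ?thesis ..
  qed
qed (auto simp: free_semigroup_inf_eq le_r_pos_word)


section \<open>C*-algebras\<close>

text \<open>C*-algebras are not assumed to be unital: the field \<open>one\<close> inherited from the record
  \<open>ring\<close> is left unconstrained and is never used.\<close>

record 'a cstar = "'a ring" +
  scale :: "complex \<Rightarrow> 'a \<Rightarrow> 'a"
  star :: "'a \<Rightarrow> 'a"
  cnorm :: "'a \<Rightarrow> real"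

definition cstar_Cauchy :: "('a, 'm) cstar_scheme \<Rightarrow> (nat \<Rightarrow> 'a) \<Rightarrow> bool" where
  "cstar_Cauchy A X \<longleftrightarrow>
     (\<forall>e>0. \<exists>N. \<forall>m\<ge>N. \<forall>n\<ge>N. cnorm A (X m \<ominus>\<^bsub>A\<^esub> X n) < e)"

definition cstar_tendsto :: "('a, 'm) cstar_scheme \<Rightarrow> (nat \<Rightarrow> 'a) \<Rightarrow> 'a \<Rightarrow> bool" where
  "cstar_tendsto A X x \<longleftrightarrow> (\<lambda>n. cnorm A (X n \<ominus>\<^bsub>A\<^esub> x)) \<longlonglongrightarrow> 0"

locale cstar_algebra = abelian_group A for A :: "('a, 'm) cstar_scheme" (structure) +
  assumes mult_closed: "\<lbrakk>x \<in> carrier A; y \<in> carrier A\<rbrakk> \<Longrightarrow> x \<otimes> y \<in> carrier A"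
    and mult_assoc: "\<lbrakk>x \<in> carrier A; y \<in> carrier A; z \<in> carrier A\<rbrakk>
      \<Longrightarrow> (x \<otimes> y) \<otimes> z = x \<otimes> (y \<otimes> z)"
    and distrib_right: "\<lbrakk>x \<in> carrier A; y \<in> carrier A; z \<in> carrier A\<rbrakk>
      \<Longrightarrow> (x \<oplus> y) \<otimes> z = x \<otimes> z \<oplus> y \<otimes> z"
    and distrib_left: "\<lbrakk>x \<in> carrier A; y \<in> carrier A; z \<in> carrier A\<rbrakk>
      \<Longrightarrow> z \<otimes> (x \<oplus> y) = z \<otimes> x \<oplus> z \<otimes> y"
    and scale_closed: "x \<in> carrier A \<Longrightarrow> scale A c x \<in> carrier A"
    and scale_add_right: "\<lbrakk>x \<in> carrier A; y \<in> carrier A\<rbrakk>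
      \<Longrightarrow> scale A c (x \<oplus> y) = scale A c x \<oplus> scale A c y"
    and scale_add_left: "x \<in> carrier A \<Longrightarrow> scale A (c + d) x = scale A c x \<oplus> scale A d x"
    and scale_scale: "x \<in> carrier A \<Longrightarrow> scale A c (scale A d x) = scale A (c * d) x"
    and scale_one: "x \<in> carrier A \<Longrightarrow> scale A 1 x = x"
    and mult_scale_left: "\<lbrakk>x \<in> carrier A; y \<in> carrier A\<rbrakk>
      \<Longrightarrow> scale A c x \<otimes> y = scale A c (x \<otimes> y)"
    and mult_scale_right: "\<lbrakk>x \<in> carrier A; y \<in> carrier A\<rbrakk>
      \<Longrightarrow> x \<otimes> scale A c y = scale A c (x \<otimes> y)"
    and star_closed: "x \<in> carrier A \<Longrightarrow> star A x \<in> carrier A"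
    and star_star: "x \<in> carrier A \<Longrightarrow> star A (star A x) = x"
    and star_add: "\<lbrakk>x \<in> carrier A; y \<in> carrier A\<rbrakk> \<Longrightarrow> star A (x \<oplus> y) = star A x \<oplus> star A y"
    and star_scale: "x \<in> carrier A \<Longrightarrow> star A (scale A c x) = scale A (cnj c) (star A x)"
    and star_mult: "\<lbrakk>x \<in> carrier A; y \<in> carrier A\<rbrakk> \<Longrightarrow> star A (x \<otimes> y) = star A y \<otimes> star A x"
    and norm_nonneg: "x \<in> carrier A \<Longrightarrow> 0 \<le> cnorm A x"
    and norm_eq_0_iff: "x \<in> carrier A \<Longrightarrow> cnorm A x = 0 \<longleftrightarrow> x = \<zero>"
    and norm_triangle: "\<lbrakk>x \<in> carrier A; y \<in> carrier A\<rbrakk>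
      \<Longrightarrow> cnorm A (x \<oplus> y) \<le> cnorm A x + cnorm A y"
    and norm_scale: "x \<in> carrier A \<Longrightarrow> cnorm A (scale A c x) = cmod c * cnorm A x"
    and norm_mult: "\<lbrakk>x \<in> carrier A; y \<in> carrier A\<rbrakk>
      \<Longrightarrow> cnorm A (x \<otimes> y) \<le> cnorm A x * cnorm A y"
    and cstar_identity: "x \<in> carrier A \<Longrightarrow> cnorm A (star A x \<otimes> x) = (cnorm A x)\<^sup>2"
    and complete: "\<lbrakk>\<And>n. X n \<in> carrier A; cstar_Cauchy A X\<rbrakk>
      \<Longrightarrow> \<exists>x\<in>carrier A. cstar_tendsto A X x"

definition cstar_subalgebra :: "('a, 'm) cstar_scheme \<Rightarrow> 'a set \<Rightarrow> bool" where
  "cstar_subalgebra A D \<longleftrightarrow>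
     D \<subseteq> carrier A \<and> \<zero>\<^bsub>A\<^esub> \<in> D \<and>
     (\<forall>x\<in>D. \<forall>y\<in>D. x \<oplus>\<^bsub>A\<^esub> y \<in> D \<and> x \<otimes>\<^bsub>A\<^esub> y \<in> D) \<and>
     (\<forall>x\<in>D. \<forall>c. scale A c x \<in> D) \<and>
     (\<forall>x\<in>D. star A x \<in> D) \<and>
     (\<forall>X x. (\<forall>n. X n \<in> D) \<longrightarrow> x \<in> carrier A \<longrightarrow> cstar_tendsto A X x \<longrightarrow> x \<in> D)"

definition cstar_generated :: "('a, 'm) cstar_scheme \<Rightarrow> 'a set \<Rightarrow> 'a set" where
  "cstar_generated A E = \<Inter>{D. cstar_subalgebra A D \<and> E \<subseteq> D}"

definition cstar_hom ::
  "('a, 'm) cstar_scheme \<Rightarrow> 'a set \<Rightarrow> ('b, 'n) cstar_scheme \<Rightarrow> ('a \<Rightarrow> 'b) \<Rightarrow> bool" where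
  "cstar_hom A D B \<phi> \<longleftrightarrow>
     (\<forall>x\<in>D. \<phi> x \<in> carrier B) \<and>
     (\<forall>x\<in>D. \<forall>y\<in>D. \<phi> (x \<oplus>\<^bsub>A\<^esub> y) = \<phi> x \<oplus>\<^bsub>B\<^esub> \<phi> y \<and> \<phi> (x \<otimes>\<^bsub>A\<^esub> y) = \<phi> x \<otimes>\<^bsub>B\<^esub> \<phi> y) \<and>
     (\<forall>x\<in>D. \<forall>c. \<phi> (scale A c x) = scale B c (\<phi> x)) \<and>
     (\<forall>x\<in>D. \<phi> (star A x) = star B (\<phi> x))"


section \<open>Bicovariant partial isometric representations\<close>

definition partial_isometry :: "('a, 'm) cstar_scheme \<Rightarrow> 'a \<Rightarrow> bool" where
  "partial_isometry A v \<longleftrightarrow> v \<in> carrier A \<and> v \<otimes>\<^bsub>A\<^esub> star A v \<otimes>\<^bsub>A\<^esub> v = v"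

text \<open>As in a homomorphism of semigroups, the image of the identity element is only required to
  be a partial isometry, not a unit. Only the values of a representation on the positive cone
  matter.\<close>

definition partial_isometric_rep :: "('a, 'm) cstar_scheme \<Rightarrow> (word \<Rightarrow> 'a) \<Rightarrow> bool" where
  "partial_isometric_rep A S \<longleftrightarrow>
     (\<forall>\<mu>\<in>\<F>\<^sub>\<infinity>\<^sup>+. partial_isometry A (S \<mu>)) \<and>
     (\<forall>\<mu>\<in>\<F>\<^sub>\<infinity>\<^sup>+. \<forall>\<nu>\<in>\<F>\<^sub>\<infinity>\<^sup>+. S (\<mu> \<otimes>\<^bsub>\<F>\<^sub>\<infinity>\<^esub> \<nu>) = S \<mu> \<otimes>\<^bsub>A\<^esub> S \<nu>)"

definition range_proj :: "('a, 'm) cstar_scheme \<Rightarrow> (word \<Rightarrow> 'a) \<Rightarrow> word \<Rightarrow> 'a" where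
  "range_proj A S \<mu> = S \<mu> \<otimes>\<^bsub>A\<^esub> star A (S \<mu>)"

definition initial_proj :: "('a, 'm) cstar_scheme \<Rightarrow> (word \<Rightarrow> 'a) \<Rightarrow> word \<Rightarrow> 'a" where
  "initial_proj A S \<mu> = star A (S \<mu>) \<otimes>\<^bsub>A\<^esub> S \<mu>"

definition bicovariant_rep :: "('a, 'm) cstar_scheme \<Rightarrow> (word \<Rightarrow> 'a) \<Rightarrow> bool" where
  "bicovariant_rep A S \<longleftrightarrow>
     partial_isometric_rep A S \<and>
     (\<forall>\<mu>\<in>\<F>\<^sub>\<infinity>\<^sup>+. \<forall>\<nu>\<in>\<F>\<^sub>\<infinity>\<^sup>+.
        range_proj A S \<mu> \<otimes>\<^bsub>A\<^esub> range_proj A S \<nu> =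
          (case join_l \<mu> \<nu> of Some \<kappa> \<Rightarrow> range_proj A S \<kappa> | None \<Rightarrow> \<zero>\<^bsub>A\<^esub>) \<and>
        initial_proj A S \<mu> \<otimes>\<^bsub>A\<^esub> initial_proj A S \<nu> =
          (case join_r \<mu> \<nu> of Some \<kappa> \<Rightarrow> initial_proj A S \<kappa> | None \<Rightarrow> \<zero>\<^bsub>A\<^esub>))"

text \<open>A HOL formula cannot quantify over all C*-algebras of all types, so the target algebras
  range over all C*-algebras whose carrier is a set of elements of the type \<open>'b\<close>. Since
  C*(W) is separable for every W, it has at most the cardinality of the continuum; hence this
  expresses universality with respect to all C*-algebras as soon as \<open>'b\<close> has at least
  continuum many elements.\<close>

definition universal_rep :: "'b itself \<Rightarrow> ('a, 'm) cstar_scheme \<Rightarrow> (word \<Rightarrow> 'a) \<Rightarrow> bool" where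
  "universal_rep TYPE('b) A S \<longleftrightarrow>
     (\<forall>(B :: 'b cstar) W. cstar_algebra B \<longrightarrow> bicovariant_rep B W \<longrightarrow>
        (\<exists>\<phi>. cstar_hom A (cstar_generated A (S ` \<F>\<^sub>\<infinity>\<^sup>+)) B \<phi> \<and>
             (\<forall>\<mu>\<in>\<F>\<^sub>\<infinity>\<^sup>+. \<phi> (S \<mu>) = W \<mu>)))"

end

theory Submission
  imports "HOL-Analysis.L2_Norm" "HOL-Analysis.Abstract_Topology_2" "HOL-Library.Sublist" Defs
begin

text \<open>Let \<open>S\<close> have no zero values and let \<open>p\<close> be a *-polynomial in the generators. The words in the
  generators and their adjoints act on the cuts \<open>(u, v)\<close> of words by moving the cut, so \<open>p\<close> has a
  matrix indexed by cuts. Every entry of this matrix is at most the norm of \<open>p(S)\<close>, because \<open>C*(S)\<close>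
  contains copies of the corresponding vectors. Conversely, for every bicovariant \<open>W\<close> the norm of
  \<open>p(W)\<close> is at most \<open>2 L + 1\<close> times the largest entry, where \<open>L\<close> bounds the lengths of the words in
  \<open>p\<close>: split \<open>p\<close> into homogeneous parts, and use that the part of degree zero is a combination of
  commuting projections. Applying both bounds to the iterated squares \<open>q* q\<close> of \<open>p\<close>, for which the
  factor \<open>2 L + 1\<close> only doubles at each step while the norms are squared, removes this factor. Hence
  \<open>p(S) \<mapsto> p(W)\<close> is contractive and extends to \<open>C*(S)\<close>. For the converse implication, compressing
  the action on cuts to the cuts of a single word \<open>m\<close> gives a bicovariant representation by finite
  matrices that does not vanish at \<open>m\<close>.\<close>

section \<open>C*-algebras\<close>

text \<open>The matrix entries depend on the polynomial alone, so they can mediate between the norms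
  of two unrelated C*-algebras. The lower bound is where both the nonvanishing of \<open>S\<close>
  and the infinity of the generators enter: a letter foreign to \<open>p\<close> and to two given
  cuts marks both ends of a word, so no monomial of \<open>p\<close> can push the cut past an end,
  and the marked words must not be sent to zero. The upper bound must hold for every
  \<open>W\<close>, degenerate or not, and is obtained from the C*-identity instead of a gauge
  action or a Hilbert space. Its key is rigidity: a cut and a degree determine the target cut, so a
  homogeneous \<open>q\<close> has at most one nonzero entry per column and \<open>q* q\<close> is
  diagonal. Different degrees are only controlled by the triangle inequality, and a word of length
  at most \<open>L\<close> has one of \<open>2 L + 1\<close> degrees. For the converse, universality
  yields information about \<open>S\<close> at \<open>m\<close> only through a target that survives
  at \<open>m\<close>; since the elements of a target must have type \<open>'b\<close>, the matrices
  have to be copied into that type.\<close>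

lemma power_iterate_le:
  fixes a b K :: real
  assumes "0 \<le> a" "0 \<le> b" and le: "\<And>k. a ^ (2 ^ k) \<le> K * 2 ^ k * b ^ (2 ^ k)"
  shows "a \<le> b"
proof (rule ccontr)
  assume "\<not> a \<le> b"
  then have "b < a" by simp
  show False
  proof (cases "b = 0")
    case True
    then show False using le[of 0] \<open>b < a\<close> by simp
  next
    case False
    then have "0 < b" using assms by simp
    define q where "q = a / b - 1"
    have "0 < q" using \<open>0 < b\<close> \<open>b < a\<close> by (simp add: q_def)
    \<comment> \<open>With n = 2 ^ k the factor K * 2 ^ k is linear in n, so Bernoulli's linear
      bound for (1 + q) ^ n does not contradict it. The quadratic binomial term does.\<close>
    have growth: "real n * (real n - 1) / 2 * q\<^sup>2 \<le> (1 + q) ^ n" for n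
    proof (induction n)
      case (Suc n)
      have "1 + real n * q \<le> (1 + q) ^ n"
        using \<open>0 < q\<close> by (intro Bernoulli_inequality) simp
      then have "q * (real n * q) \<le> q * (1 + q) ^ n"
        using \<open>0 < q\<close> by (intro mult_left_mono) auto
      then show ?case using Suc by (simp add: power2_eq_square field_simps)
    qed simp
    have "(1 + q) ^ (2 ^ k) \<le> K * 2 ^ k" for k
    proof -
      have "(1 + q) ^ (2 ^ k) = a ^ (2 ^ k) / b ^ (2 ^ k)"
        by (simp add: q_def power_divide)
      also have "\<dots> \<le> K * 2 ^ k"
        using le[of k] \<open>0 < b\<close> by (simp add: divide_simps mult_ac)
      finally show ?thesis .
    qed
    then have "2 ^ k * ((2 ^ k - 1) / 2 * q\<^sup>2) \<le> 2 ^ k * K" for k :: nat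
      using order_trans[OF growth[of "2 ^ k"], of "K * 2 ^ k"] by (simp add: mult_ac)
    then have *: "(2 ^ k - 1) / 2 * q\<^sup>2 \<le> K" for k :: nat
      using mult_le_cancel_left_pos[of "2 ^ k :: real"] by (metis zero_less_numeral zero_less_power)
    obtain k :: nat where "2 * K / q\<^sup>2 + 1 < 2 ^ k"
      using real_arch_pow[of 2 "2 * K / q\<^sup>2 + 1"] by auto
    then have "K < (2 ^ k - 1) / 2 * q\<^sup>2"
      using \<open>0 < q\<close> by (simp add: field_simps)
    then show False using *[of k] by simp
  qed
qed

context cstar_algebra
begin

declare mult_closed [simp, intro] scale_closed [simp, intro] star_closed [simp, intro]
  star_star [simp] scale_one [simp] norm_nonneg [simp]

lemma l_null [simp]: assumes "x \<in> carrier A" shows "\<zero> \<otimes> x = \<zero>"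
proof -
  have "\<zero> \<otimes> x \<oplus> \<zero> \<otimes> x = \<zero> \<otimes> x"
    using distrib_right[of \<zero> \<zero> x] assms by simp
  then show ?thesis using assms by (metis add.l_cancel_one mult_closed zero_closed)
qed

lemma r_null [simp]: assumes "x \<in> carrier A" shows "x \<otimes> \<zero> = \<zero>"
proof -
  have "x \<otimes> \<zero> \<oplus> x \<otimes> \<zero> = x \<otimes> \<zero>"
    using distrib_left[of \<zero> \<zero> x] assms by simp
  then show ?thesis using assms by (metis add.l_cancel_one mult_closed zero_closed)
qed

lemma scale_zero_left [simp]: assumes "x \<in> carrier A" shows "scale A 0 x = \<zero>"
proof -
  have "scale A 0 x \<oplus> scale A 0 x = scale A 0 x"
    using scale_add_left[of x 0 0] assms by simp
  then show ?thesis using assms by (metis add.l_cancel_one scale_closed)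
qed

lemma scale_zero_right [simp]: "scale A c \<zero> = \<zero>"
  by (metis scale_scale scale_zero_left mult_zero_right zero_closed)

lemma star_zero [simp]: "star A \<zero> = \<zero>"
  by (metis complex_cnj_zero scale_zero_left star_closed star_scale zero_closed)

lemma a_inv_eq_scale: assumes "x \<in> carrier A" shows "\<ominus> x = scale A (- 1) x"
  using assms scale_add_left[of x "- 1" 1] by (intro minus_equality) auto

lemma minus_eq_scale:
  "\<lbrakk>x \<in> carrier A; y \<in> carrier A\<rbrakk> \<Longrightarrow> x \<ominus> y = x \<oplus> scale A (- 1) y"
  by (simp add: a_minus_def a_inv_eq_scale)

lemma minus_self [simp]: "x \<in> carrier A \<Longrightarrow> x \<ominus> x = \<zero>"
  by (simp add: a_minus_def r_neg)

lemma minus_zero_right [simp]: "x \<in> carrier A \<Longrightarrow> x \<ominus> \<zero> = x"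
  by (simp add: minus_eq_scale)

lemma minus_eq_zero_iff:
  "\<lbrakk>x \<in> carrier A; y \<in> carrier A\<rbrakk> \<Longrightarrow> x \<ominus> y = \<zero> \<longleftrightarrow> x = y"
  by (metis a_minus_def a_inv_closed minus_equality minus_minus minus_self)

lemma l_distrib_minus:
  "\<lbrakk>x \<in> carrier A; y \<in> carrier A; z \<in> carrier A\<rbrakk> \<Longrightarrow> (x \<ominus> y) \<otimes> z = x \<otimes> z \<ominus> y \<otimes> z"
  by (simp add: minus_eq_scale distrib_right mult_scale_left)

lemma r_distrib_minus:
  "\<lbrakk>x \<in> carrier A; y \<in> carrier A; z \<in> carrier A\<rbrakk> \<Longrightarrow> z \<otimes> (x \<ominus> y) = z \<otimes> x \<ominus> z \<otimes> y"
  by (simp add: minus_eq_scale distrib_left mult_scale_right)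

lemma star_minus: "\<lbrakk>x \<in> carrier A; y \<in> carrier A\<rbrakk> \<Longrightarrow> star A (x \<ominus> y) = star A x \<ominus> star A y"
  by (simp add: minus_eq_scale star_add star_scale)

lemma norm_zero [simp]: "cnorm A \<zero> = 0"
  by (simp add: norm_eq_0_iff)

text \<open>Isometry of the star is not among the axioms. The C*-identity and submultiplicativity
  bound the square of \<open>cnorm A y\<close> by \<open>cnorm A (star A y) * cnorm A y\<close>, and
  a nonzero norm cancels.\<close>

lemma norm_star [simp]: assumes "x \<in> carrier A" shows "cnorm A (star A x) = cnorm A x"
proof -
  have *: "cnorm A y \<le> cnorm A (star A y)" if "y \<in> carrier A" for y
  proof (cases "y = \<zero>")
    case False
    have "cnorm A y * cnorm A y \<le> cnorm A (star A y) * cnorm A y"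
      using cstar_identity[OF that] norm_mult[of "star A y" y] that by (simp add: power2_eq_square)
    moreover have "0 < cnorm A y"
      using False that by (simp add: norm_eq_0_iff order_less_le)
    ultimately show ?thesis by simp
  qed simp
  show ?thesis using *[of x] *[of "star A x"] assms by simp
qed

lemma star_mult_self_eq_zero: "\<lbrakk>x \<in> carrier A; star A x \<otimes> x = \<zero>\<rbrakk> \<Longrightarrow> x = \<zero>"
  using cstar_identity[of x] by (simp add: norm_eq_0_iff)

lemma mult_star_self_eq_zero: "\<lbrakk>x \<in> carrier A; x \<otimes> star A x = \<zero>\<rbrakk> \<Longrightarrow> x = \<zero>"
  using star_mult_self_eq_zero[of "star A x"] by (metis star_closed star_star star_zero)

lemma norm_minus_commute:
  "\<lbrakk>x \<in> carrier A; y \<in> carrier A\<rbrakk> \<Longrightarrow> cnorm A (x \<ominus> y) = cnorm A (y \<ominus> x)"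
  using norm_scale[of "y \<ominus> x" "-1"]
  by (simp add: minus_eq_scale scale_add_right scale_scale a_comm)

lemma minus_split:
  assumes "x \<in> carrier A" "y \<in> carrier A" "z \<in> carrier A"
  shows "x \<ominus> z = (x \<ominus> y) \<oplus> (y \<ominus> z)"
  using assms by (simp add: a_minus_def) (metis a_assoc a_inv_closed l_neg l_zero a_closed)

lemma add_diff_add:
  assumes "x \<in> carrier A" "y \<in> carrier A" "x' \<in> carrier A" "y' \<in> carrier A"
  shows "(x \<oplus> y) \<ominus> (x' \<oplus> y') = (x \<ominus> x') \<oplus> (y \<ominus> y')"
  using assms by (simp add: minus_eq_scale scale_add_right a_ac)

lemma norm_minus_triangle:
  assumes "x \<in> carrier A" "y \<in> carrier A" "z \<in> carrier A"
  shows "cnorm A (x \<ominus> z) \<le> cnorm A (x \<ominus> y) + cnorm A (y \<ominus> z)"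
  using assms minus_split[OF assms] norm_triangle[of "x \<ominus> y" "y \<ominus> z"] by simp

lemma norm_triangle_minus:
  assumes "x \<in> carrier A" "y \<in> carrier A"
  shows "cnorm A x \<le> cnorm A y + cnorm A (x \<ominus> y)"
  using norm_minus_triangle[of x y \<zero>] assms by simp

section \<open>Projections in a C*-algebra\<close>

definition proj :: "'a \<Rightarrow> bool" where
  "proj p \<longleftrightarrow> p \<in> carrier A \<and> star A p = p \<and> p \<otimes> p = p"

lemma proj_closed [simp]: "proj p \<Longrightarrow> p \<in> carrier A"
  and proj_star: "proj p \<Longrightarrow> star A p = p"
  and proj_idem: "proj p \<Longrightarrow> p \<otimes> p = p"
  by (auto simp: proj_def)

lemma proj_norm: assumes "proj p" "p \<noteq> \<zero>" shows "cnorm A p = 1"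
proof -
  have "cnorm A p = cnorm A p * cnorm A p"
    using cstar_identity[of p] assms by (simp add: proj_def power2_eq_square)
  moreover have "cnorm A p \<noteq> 0"
    using assms by (simp add: norm_eq_0_iff)
  ultimately show ?thesis by simp
qed

lemma proj_mult:
  assumes "proj p" "proj q" "p \<otimes> q = q \<otimes> p" shows "proj (p \<otimes> q)"
proof -
  have "p \<otimes> q \<otimes> (p \<otimes> q) = p \<otimes> (q \<otimes> p) \<otimes> q"
    using assms(1,2) by (simp add: mult_assoc)
  also have "\<dots> = p \<otimes> (p \<otimes> q) \<otimes> q"
    by (simp only: assms(3))
  also have "\<dots> = p \<otimes> p \<otimes> (q \<otimes> q)"
    using assms(1,2) by (simp only: mult_assoc mult_closed proj_closed)
  finally show ?thesis
    using assms by (simp add: proj_def star_mult)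
qed

lemma proj_minus:
  assumes "proj p" "proj q" "p \<otimes> q = q \<otimes> p" shows "proj (p \<ominus> p \<otimes> q)"
proof -
  have 1: "p \<otimes> (p \<otimes> q) = p \<otimes> q"
    using assms(1,2) by (simp add: proj_idem flip: mult_assoc)
  have "p \<otimes> q \<otimes> p = p \<otimes> (q \<otimes> p)"
    using assms(1,2) by (simp add: mult_assoc)
  then have 2: "p \<otimes> q \<otimes> p = p \<otimes> q"
    using 1 by (simp only: assms(3))
  have 3: "p \<otimes> q \<otimes> (p \<otimes> q) = p \<otimes> q"
    using proj_mult[OF assms] by (simp add: proj_idem)
  have "(p \<ominus> p \<otimes> q) \<otimes> (p \<ominus> p \<otimes> q) = (p \<ominus> p \<otimes> q) \<ominus> (p \<otimes> q \<ominus> p \<otimes> q)"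
    using assms(1,2) by (simp add: l_distrib_minus r_distrib_minus 1 2 3 proj_idem)
  then show ?thesis
    using assms by (simp add: proj_def star_minus star_mult)
qed

text \<open>If the product of two projections is idempotent, then they commute: the element
  \<open>d = p q - p q p\<close> satisfies \<open>d d* = 0\<close>.\<close>

lemma proj_commute:
  assumes p: "proj p" and q: "proj q" and pq: "p \<otimes> q \<otimes> (p \<otimes> q) = p \<otimes> q"
  shows "p \<otimes> q = q \<otimes> p"
proof -
  have c: "p \<in> carrier A" "q \<in> carrier A" using p q by auto
  have pp: "p \<otimes> p = p" "p \<otimes> (p \<otimes> x) = p \<otimes> x" if "x \<in> carrier A" for x
    using that p by (simp_all add: proj_idem flip: mult_assoc)
  have qq: "q \<otimes> q = q" "q \<otimes> (q \<otimes> x) = q \<otimes> x" if "x \<in> carrier A" for x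
    using that q by (simp_all add: proj_idem flip: mult_assoc)
  have pqpq: "p \<otimes> (q \<otimes> (p \<otimes> (q \<otimes> x))) = p \<otimes> (q \<otimes> x)" if "x \<in> carrier A" for x
  proof -
    have "p \<otimes> (q \<otimes> (p \<otimes> (q \<otimes> x))) = (p \<otimes> q \<otimes> (p \<otimes> q)) \<otimes> x"
      using that c by (simp only: mult_assoc mult_closed)
    then show ?thesis using that c pq by (simp add: mult_assoc)
  qed
  define d where "d = p \<otimes> q \<ominus> p \<otimes> q \<otimes> p"
  have "d \<in> carrier A" using c by (simp add: d_def)
  have "d \<otimes> star A d = \<zero>"
    using c p q by (simp add: d_def star_minus star_mult proj_star l_distrib_minus r_distrib_minus
        mult_assoc pp qq pqpq)
  then have "d = \<zero>"
    by (rule mult_star_self_eq_zero[OF \<open>d \<in> carrier A\<close>])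
  then have *: "p \<otimes> q = p \<otimes> q \<otimes> p"
    using c by (simp add: d_def minus_eq_zero_iff)
  have "star A (p \<otimes> q \<otimes> p) = p \<otimes> q \<otimes> p"
    using c p q by (simp add: star_mult proj_star mult_assoc)
  then have "star A (p \<otimes> q) = p \<otimes> q"
    using * by metis
  then show ?thesis using star_mult[OF c] by (simp only: p q proj_star)
qed

text \<open>By the C*-identity every step squares the norm exactly, whereas for plain powers
  submultiplicativity gives only an upper bound.\<close>

fun sq_iter :: "'a \<Rightarrow> nat \<Rightarrow> 'a" where
  "sq_iter x 0 = x"
| "sq_iter x (Suc k) = star A (sq_iter x k) \<otimes> sq_iter x k"

lemma sq_iter_closed [simp]: "x \<in> carrier A \<Longrightarrow> sq_iter x k \<in> carrier A"
  by (induction k) auto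

lemma norm_sq_iter: "x \<in> carrier A \<Longrightarrow> cnorm A (sq_iter x k) = cnorm A x ^ (2 ^ k)"
  by (induction k) (auto simp: cstar_identity mult.commute simp flip: power_mult)

text \<open>The iterated squares of \<open>a \<oplus> b\<close> are sums of those of
  \<open>a\<close> and \<open>b\<close>, so the triangle inequality costs a factor 2 however large
  the exponent is, and \<open>power_iterate_le\<close> discards this factor.\<close>

lemma norm_orthogonal_add_le:
  assumes a: "a \<in> carrier A" "cnorm A a \<le> M" and b: "b \<in> carrier A" "cnorm A b \<le> M"
    and orth: "star A a \<otimes> b = \<zero>" "a \<otimes> star A b = \<zero>"
  shows "cnorm A (a \<oplus> b) \<le> M"
proof (rule power_iterate_le)
  fix k :: nat
  \<comment> \<open>The first relation removes the cross terms of the next square; the second makes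
    the two new squares orthogonal again.\<close>
  have orth': "star A (sq_iter a k) \<otimes> sq_iter b k = \<zero> \<and> sq_iter a k \<otimes> star A (sq_iter b k) = \<zero>
      \<and> sq_iter (a \<oplus> b) k = sq_iter a k \<oplus> sq_iter b k" (is "?P k")
  proof (induction k)
    case 0
    then show ?case using orth by simp
  next
    case (Suc k)
    let ?a = "sq_iter a k" and ?b = "sq_iter b k"
    have c: "?a \<in> carrier A" "?b \<in> carrier A" using a b by auto
    have 1: "star A ?a \<otimes> ?b = \<zero>" "?a \<otimes> star A ?b = \<zero>"
      "sq_iter (a \<oplus> b) k = ?a \<oplus> ?b" using Suc by auto
    have 2: "star A ?b \<otimes> ?a = \<zero>"
      using 1(1) c by (metis star_closed star_mult star_star star_zero)
    have "star A ?a \<otimes> ?a \<otimes> (star A ?b \<otimes> ?b) = star A ?a \<otimes> (?a \<otimes> star A ?b) \<otimes> ?b"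
      using c by (simp only: mult_assoc mult_closed star_closed)
    then show ?case
      using c by (simp add: 1 2 star_mult star_add distrib_left distrib_right)
  qed
  have "cnorm A (a \<oplus> b) ^ (2 ^ k) = cnorm A (sq_iter a k \<oplus> sq_iter b k)"
    using norm_sq_iter[of "a \<oplus> b" k] a b orth' by simp
  also have "\<dots> \<le> cnorm A a ^ (2 ^ k) + cnorm A b ^ (2 ^ k)"
    using norm_triangle[of "sq_iter a k" "sq_iter b k"] a b by (simp add: norm_sq_iter)
  also have "\<dots> \<le> M ^ (2 ^ k) + M ^ (2 ^ k)"
    using a b by (intro add_mono power_mono) auto
  also have "\<dots> \<le> 2 * 2 ^ k * M ^ (2 ^ k)"
    using norm_nonneg[OF a(1)] a(2) by (simp add: mult_right_mono)
  finally show "cnorm A (a \<oplus> b) ^ (2 ^ k) \<le> 2 * 2 ^ k * M ^ (2 ^ k)" .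
next
  show "0 \<le> M" using norm_nonneg[OF a(1)] a(2) by linarith
qed (use a b in auto)

lemma partial_isometry_norm:
  assumes "partial_isometry A v" "v \<noteq> \<zero>"
  shows "cnorm A v = 1"
proof -
  have v: "v \<in> carrier A" "v \<otimes> star A v \<otimes> v = v"
    using assms by (auto simp: partial_isometry_def)
  have "star A v \<otimes> v \<otimes> (star A v \<otimes> v) = star A v \<otimes> (v \<otimes> star A v \<otimes> v)"
    by (simp only: mult_assoc v(1) mult_closed star_closed)
  then have "proj (star A v \<otimes> v)"
    using v(1) by (simp add: proj_def star_mult v(2))
  moreover have "star A v \<otimes> v \<noteq> \<zero>"
    using assms(2) v star_mult_self_eq_zero by blast
  ultimately have "(cnorm A v)\<^sup>2 = 1"
    using proj_norm cstar_identity[OF v(1)] by simp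
  then show ?thesis using norm_nonneg[OF v(1)] by (auto simp: power2_eq_1_iff)
qed

end

section \<open>Bicovariant representations\<close>

lemma pos_word_mem [simp]: "pos_word xs \<in> \<F>\<^sub>\<infinity>\<^sup>+"
  by (simp add: free_semigroup_inf_eq)

text \<open>On lists \<open>le_l\<close> is the prefix order, and two prefixes of one word are
  comparable. So a join, if there is one, is the longer of the two words.\<close>

lemma join_l_pos_word:
  "join_l (pos_word xs) (pos_word ys) =
     (if prefix xs ys then Some (pos_word ys) else if prefix ys xs then Some (pos_word xs) else None)"
proof -
  have le: "le_l (pos_word as) (pos_word bs) \<longleftrightarrow> prefix as bs" for as bs
    by (simp add: le_l_pos_word prefix_def)
  have join: "is_join le_l (pos_word xs) (pos_word ys) (pos_word zs) \<longleftrightarrow>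
      prefix xs zs \<and> prefix ys zs \<and> (\<forall>bs. prefix xs bs \<and> prefix ys bs \<longrightarrow> prefix zs bs)" for zs
    by (auto simp: is_join_def is_upper_bound_def le free_semigroup_inf_eq) (metis le rangeI)
  show ?thesis
  proof (cases "prefix xs ys \<or> prefix ys xs")
    case True
    then show ?thesis by (auto simp: join_l_eq_Some_iff join)
  next
    case False
    have "join_l (pos_word xs) (pos_word ys) \<noteq> Some \<kappa>" for \<kappa>
    proof
      assume *: "join_l (pos_word xs) (pos_word ys) = Some \<kappa>"
      then have "\<kappa> \<in> \<F>\<^sub>\<infinity>\<^sup>+"
        by (simp add: join_l_eq_Some_iff is_join_def is_upper_bound_def)
      then obtain zs where "\<kappa> = pos_word zs" by (auto simp: free_semigroup_inf_eq)
      with * have "prefix xs zs" "prefix ys zs" by (auto simp: join_l_eq_Some_iff join)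
      with False show False using prefix_same_cases by blast
    qed
    with False show ?thesis by auto
  qed
qed

lemma join_r_pos_word:
  "join_r (pos_word xs) (pos_word ys) =
     (if suffix xs ys then Some (pos_word ys) else if suffix ys xs then Some (pos_word xs) else None)"
proof -
  have le: "le_r (pos_word as) (pos_word bs) \<longleftrightarrow> suffix as bs" for as bs
    by (simp add: le_r_pos_word suffix_def)
  have join: "is_join le_r (pos_word xs) (pos_word ys) (pos_word zs) \<longleftrightarrow>
      suffix xs zs \<and> suffix ys zs \<and> (\<forall>bs. suffix xs bs \<and> suffix ys bs \<longrightarrow> suffix zs bs)" for zs
    by (auto simp: is_join_def is_upper_bound_def le free_semigroup_inf_eq) (metis le rangeI)
  show ?thesis
  proof (cases "suffix xs ys \<or> suffix ys xs")
    case True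
    then show ?thesis by (auto simp: join_r_eq_Some_iff join)
  next
    case False
    have "join_r (pos_word xs) (pos_word ys) \<noteq> Some \<kappa>" for \<kappa>
    proof
      assume *: "join_r (pos_word xs) (pos_word ys) = Some \<kappa>"
      then have "\<kappa> \<in> \<F>\<^sub>\<infinity>\<^sup>+"
        by (simp add: join_r_eq_Some_iff is_join_def is_upper_bound_def)
      then obtain zs where "\<kappa> = pos_word zs" by (auto simp: free_semigroup_inf_eq)
      with * have "suffix xs zs" "suffix ys zs" by (auto simp: join_r_eq_Some_iff join)
      with False show False using suffix_same_cases by blast
    qed
    with False show ?thesis by auto
  qed
qed

text \<open>A zipper \<open>(u, v)\<close> is a cut of the word \<open>rev u @ v\<close>. The generators and their adjoints move
  the cut by one letter.\<close>

type_synonym zipper = "nat list \<times> nat list"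

text \<open>The left half of a cut is stored reversed, so both halves grow away from the cut and
  extending a cut on either side is the prefix order in that component.\<close>

definition zle :: "zipper \<Rightarrow> zipper \<Rightarrow> bool" where
  "zle z y \<longleftrightarrow> prefix (fst z) (fst y) \<and> prefix (snd z) (snd y)"

lemma zle_refl [simp]: "zle y y"
  by (simp add: zle_def)

lemma zle_trans: "zle x y \<Longrightarrow> zle y z \<Longrightarrow> zle x z"
  by (auto simp: zle_def)

text \<open>A relation rather than a function: a letter acts as a partial bijection of the cuts, and
  its adjoint acts by the converse relation.\<close>

fun move :: "letter \<Rightarrow> zipper \<Rightarrow> zipper \<Rightarrow> bool" where
  "move (z, False) y x \<longleftrightarrow> (\<exists>u v. y = (z # u, v) \<and> x = (u, z # v))"
| "move (z, True) y x \<longleftrightarrow> (\<exists>u v. y = (u, z # v) \<and> x = (z # u, v))"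

fun moves :: "word \<Rightarrow> zipper \<Rightarrow> zipper \<Rightarrow> bool" where
  "moves [] y x \<longleftrightarrow> x = y"
| "moves (l # w) y x \<longleftrightarrow> (\<exists>m. moves w y m \<and> move l m x)"

text \<open>The degree for the gauge action, which multiplies all generators by one complex number
  of modulus 1. On cuts it is the displacement of the cut.\<close>

fun deg :: "word \<Rightarrow> int" where
  "deg [] = 0"
| "deg (l # w) = (if snd l then - 1 else 1) + deg w"

text \<open>Words serve here as formal monomials in the generators and their adjoints and are not
  reduced: a generator times its adjoint is a projection, in general not a unit.\<close>

definition wstar :: "word \<Rightarrow> word" where
  "wstar w = rev (map inv_letter w)"

lemma move_inv_letter: "move (inv_letter l) y x \<longleftrightarrow> move l x y"
  by (cases l; cases "snd l") (auto simp: inv_letter_def)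

lemma moves_append: "moves (w @ w') y x \<longleftrightarrow> (\<exists>m. moves w' y m \<and> moves w m x)"
  by (induction w arbitrary: x) auto

lemma moves_wstar: "moves (wstar w) y x \<longleftrightarrow> moves w x y"
  by (induction w arbitrary: x y) (auto simp: wstar_def moves_append move_inv_letter)

lemma deg_append: "deg (w @ w') = deg w + deg w'"
  by (induction w) auto

lemma deg_wstar: "deg (wstar w) = - deg w"
  by (induction w) (auto simp: wstar_def deg_append inv_letter_def)

lemma length_wstar [simp]: "length (wstar w) = length w"
  by (simp add: wstar_def)

lemma abs_deg_le: "\<bar>deg w\<bar> \<le> int (length w)"
  by (induction w) auto

lemma move_invariant:
  assumes "move l y x"
  shows "rev (fst x) @ snd x = rev (fst y) @ snd y"
    and "int (length (snd x)) = int (length (snd y)) + (if snd l then - 1 else 1)"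
  using assms by (cases l; cases "snd l"; auto)+

lemma moves_invariant:
  "moves w y x \<Longrightarrow> rev (fst x) @ snd x = rev (fst y) @ snd y \<and>
     int (length (snd x)) = int (length (snd y)) + deg w"
  by (induction w arbitrary: x) (use move_invariant in \<open>fastforce+\<close>)

lemma zipper_eqI:
  assumes "rev (fst x) @ snd x = rev (fst y) @ snd y" "length (snd x) = length (snd y)"
  shows "x = y"
  using assms by (auto simp: prod_eq_iff append_eq_append_conv)

text \<open>All cuts reached from \<open>y\<close> cut the same word, and the degree fixes the
  position. Hence the matrix of a homogeneous polynomial has at most one nonzero entry in each
  column.\<close>

lemma moves_unique:
  assumes "moves w y x" "moves w' y x'" "deg w = deg w'"
  shows "x = x'"
  using moves_invariant[OF assms(1)] moves_invariant[OF assms(2)] assms(3)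
  by (intro zipper_eqI) auto

section \<open>Range and initial projections of a bicovariant representation\<close>

locale bicovariant_representation = cstar_algebra A for A :: "('a, 'm) cstar_scheme" (structure) +
  fixes S :: "word \<Rightarrow> 'a"
  assumes bicovariant: "bicovariant_rep A S"
begin

definition s :: "nat list \<Rightarrow> 'a" where
  "s xs = S (pos_word xs)"

definition I :: "nat list \<Rightarrow> 'a" where
  "I xs = star A (s xs) \<otimes> s xs"

definition R :: "nat list \<Rightarrow> 'a" where
  "R xs = s xs \<otimes> star A (s xs)"

lemma s_partial_isometry: "partial_isometry A (s xs)"
  using bicovariant by (auto simp: s_def bicovariant_rep_def partial_isometric_rep_def)

lemma s_closed [simp]: "s xs \<in> carrier A"
  using s_partial_isometry by (auto simp: partial_isometry_def)

lemma I_closed [simp]: "I xs \<in> carrier A" and R_closed [simp]: "R xs \<in> carrier A"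
  by (auto simp: I_def R_def)

lemma s_append: "s (xs @ ys) = s xs \<otimes> s ys"
  using bicovariant
  by (auto simp: s_def bicovariant_rep_def partial_isometric_rep_def simp flip: mult_pos_word)

lemma s_Cons: "s (x # ys) = s [x] \<otimes> s ys"
  using s_append[of "[x]" ys] by simp

lemma R_s: "R xs \<otimes> s xs = s xs"
  using s_partial_isometry by (auto simp: R_def partial_isometry_def)

lemma s_I: "s xs \<otimes> I xs = s xs"
  using s_partial_isometry by (auto simp: I_def partial_isometry_def mult_assoc)

lemma I_star: "star A (I xs) = I xs" and R_star: "star A (R xs) = R xs"
  by (auto simp: I_def R_def star_mult)

lemma star_s_R: "star A (s xs) \<otimes> R xs = star A (s xs)"
  using arg_cong[OF R_s[of xs], of "star A"] by (simp add: star_mult R_star)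

lemma I_star_s: "I xs \<otimes> star A (s xs) = star A (s xs)"
  using arg_cong[OF s_I[of xs], of "star A"] by (simp add: star_mult I_star)

lemma proj_I: "proj (I xs)"
proof -
  have "I xs \<otimes> I xs = star A (s xs) \<otimes> (s xs \<otimes> I xs)"
    unfolding I_def by (simp only: mult_assoc s_closed star_closed mult_closed)
  then show ?thesis unfolding s_I by (simp add: proj_def I_star) (simp add: I_def)
qed

lemma proj_R: "proj (R xs)"
proof -
  have "R xs \<otimes> R xs = R xs \<otimes> s xs \<otimes> star A (s xs)"
    unfolding R_def by (simp only: mult_assoc s_closed star_closed mult_closed)
  then show ?thesis unfolding R_s by (simp add: proj_def R_star) (simp add: R_def)
qed

lemma R_mult: "R xs \<otimes> R ys = (if prefix xs ys then R ys else if prefix ys xs then R xs else \<zero>)"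
  using bicovariant by (auto simp: bicovariant_rep_def range_proj_def join_l_pos_word R_def s_def
      dest!: bspec[of _ _ "pos_word xs"] bspec[of _ _ "pos_word ys"])

lemma I_mult: "I xs \<otimes> I ys = (if suffix xs ys then I ys else if suffix ys xs then I xs else \<zero>)"
  using bicovariant by (auto simp: bicovariant_rep_def initial_proj_def join_r_pos_word I_def s_def
      dest!: bspec[of _ _ "pos_word xs"] bspec[of _ _ "pos_word ys"])

text \<open>Bicovariance relates range projections only to each other, and likewise initial
  projections. The mixed case comes from \<open>s xs \<otimes> s ys\<close> being a partial isometry
  again: its defining identity, multiplied by \<open>star A (s xs)\<close> on the left and
  \<open>star A (s ys)\<close> on the right, says that \<open>I xs \<otimes> R ys\<close> is
  idempotent.\<close>

lemma I_R_commute: "I xs \<otimes> R ys = R ys \<otimes> I xs"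
proof (rule proj_commute[OF proj_I proj_R])
  let ?x = "s xs" and ?y = "s ys"
  have "?x \<otimes> ?y \<otimes> star A (?x \<otimes> ?y) \<otimes> (?x \<otimes> ?y) = ?x \<otimes> ?y"
    using s_partial_isometry[of "xs @ ys"] by (simp add: s_append partial_isometry_def)
  then have "star A ?x \<otimes> (?x \<otimes> ?y \<otimes> star A (?x \<otimes> ?y) \<otimes> (?x \<otimes> ?y)) \<otimes> star A ?y =
      star A ?x \<otimes> (?x \<otimes> ?y) \<otimes> star A ?y" by simp
  then show "I xs \<otimes> R ys \<otimes> (I xs \<otimes> R ys) = I xs \<otimes> R ys"
    by (simp add: I_def R_def star_mult mult_assoc)
qed

text \<open>The image of the identity is not assumed to be a unit, but an idempotent partial
  isometry e is a projection, because e - e e* is annihilated by its own adjoint. As a projection,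
  \<open>s []\<close> can replace the unit on all \<open>s xs\<close> and their adjoints.\<close>

lemma star_s_Nil: "star A (s []) = s []"
proof -
  let ?e = "s []" and ?d = "s [] \<ominus> R []"
  have ee: "?e \<otimes> ?e = ?e" using s_append[of "[]" "[]"] by simp
  have eR: "?e \<otimes> R [] = R []" using ee by (simp add: R_def flip: mult_assoc)
  have Re: "R [] \<otimes> star A ?e = R []" using arg_cong[OF eR, of "star A"] by (simp add: star_mult R_star)
  have "?d \<otimes> star A ?d = \<zero>"
    using proj_idem[OF proj_R[of "[]"]]
    by (simp add: star_minus R_star l_distrib_minus r_distrib_minus eR Re) (simp add: R_def)
  then have "?d = \<zero>" by (rule mult_star_self_eq_zero[rotated]) simp
  then have "?e = R []" by (simp add: minus_eq_zero_iff)
  then show ?thesis by (metis R_star)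
qed

lemma I_Nil: "I [] = s []" and R_Nil: "R [] = s []"
  using s_append[of "[]" "[]"] by (auto simp: I_def R_def star_s_Nil)

lemma s_Nil_left [simp]: "s [] \<otimes> s xs = s xs" and s_Nil_right [simp]: "s xs \<otimes> s [] = s xs"
  using s_append[of "[]" xs] s_append[of xs "[]"] by auto

lemma star_s_Nil_left [simp]: "s [] \<otimes> star A (s xs) = star A (s xs)"
  and star_s_Nil_right [simp]: "star A (s xs) \<otimes> s [] = star A (s xs)"
  using arg_cong[OF s_Nil_left[of xs], of "star A"] arg_cong[OF s_Nil_right[of xs], of "star A"]
  by (auto simp: star_mult star_s_Nil simp del: s_Nil_left s_Nil_right)

text \<open>In the action on cuts this is the projection onto all cuts that extend \<open>z\<close>;
  \<open>ev_deg_zero\<close> makes this precise.\<close>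

definition P :: "zipper \<Rightarrow> 'a" where
  "P z = I (rev (fst z)) \<otimes> R (snd z)"

lemma P_closed [simp]: "P z \<in> carrier A"
  by (simp add: P_def)

lemma P_Nil: "P ([], []) = s []"
  by (simp add: P_def I_Nil R_Nil)

lemma proj_P: "proj (P z)"
  unfolding P_def by (intro proj_mult proj_I proj_R I_R_commute)

lemma P_mult: "P z \<otimes> P y = (I (rev (fst z)) \<otimes> I (rev (fst y))) \<otimes> (R (snd z) \<otimes> R (snd y))"
proof -
  have "P z \<otimes> P y = I (rev (fst z)) \<otimes> (R (snd z) \<otimes> I (rev (fst y))) \<otimes> R (snd y)"
    by (simp add: P_def mult_assoc)
  then show ?thesis by (simp add: mult_assoc flip: I_R_commute)
qed

lemma P_mult_eq: "zle z y \<Longrightarrow> P z \<otimes> P y = P y"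
  by (simp add: P_mult I_mult R_mult zle_def suffix_to_prefix) (simp add: P_def)

lemma P_commute: "P z \<otimes> P y = P y \<otimes> P z"
proof -
  have "I xs \<otimes> I ys = I ys \<otimes> I xs" for xs ys by (auto simp: I_mult dest: suffix_order.antisym)
  moreover have "R xs \<otimes> R ys = R ys \<otimes> R xs" for xs ys
    by (auto simp: R_mult dest: prefix_order.antisym)
  ultimately show ?thesis unfolding P_mult by metis
qed

text \<open>Range projections multiply to the projection of the longer word or to zero, and so do
  initial projections. If neither factor vanishes, the longer halves together form the cut
  \<open>x\<close>.\<close>

lemma P_join:
  assumes "P z \<otimes> P y \<noteq> \<zero>"
  obtains x where "zle z x" "zle y x" "P z \<otimes> P y = P x"
proof -
  have "I (rev (fst z)) \<otimes> I (rev (fst y)) \<noteq> \<zero>" "R (snd z) \<otimes> R (snd y) \<noteq> \<zero>"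
    using assms unfolding P_mult by auto
  then obtain u v where "prefix (fst z) u" "prefix (fst y) u" "prefix (snd z) v" "prefix (snd y) v"
    and "I (rev (fst z)) \<otimes> I (rev (fst y)) = I (rev u)" "R (snd z) \<otimes> R (snd y) = R v"
    by (auto simp: I_mult R_mult suffix_to_prefix split: if_splits)
  then show ?thesis
    by (intro that[of "(u, v)"]) (auto simp: zle_def P_mult, simp add: P_def)
qed

end

section \<open>Partial isometries attached to cuts and the evaluation of words\<close>

context bicovariant_representation
begin

text \<open>In the action on cuts, \<open>T u v\<close> carries the cut at the right end of
  \<open>rev u @ v\<close> to the position \<open>(u, v)\<close>. So
  \<open>T u v \<otimes> star A (T a b)\<close> transfers one cut of a word to another cut of the
  same word.\<close>

definition T :: "nat list \<Rightarrow> nat list \<Rightarrow> 'a" where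
  "T u v = star A (s (rev u)) \<otimes> s (rev u @ v)"

lemma T_closed [simp]: "T u v \<in> carrier A"
  by (simp add: T_def)

lemma T_eq: "T u v = I (rev u) \<otimes> s v"
  by (simp add: T_def I_def s_append mult_assoc)

lemma T_Nil: "T [] v = s v"
  by (simp add: T_eq I_Nil)

lemma R_s_Cons: "R [z] \<otimes> s (z # v) = s (z # v)"
proof -
  have "R [z] \<otimes> s (z # v) = R [z] \<otimes> s [z] \<otimes> s v"
    by (simp add: mult_assoc flip: s_Cons)
  then show ?thesis by (simp add: R_s flip: s_Cons)
qed

text \<open>Together with the next three lemmas, this shows that left multiplication moves the cut
  of \<open>T\<close> as prescribed by \<open>move\<close>, or gives zero when the adjacent letter
  is the wrong one. Here the product creates \<open>R [z]\<close>, which commutes past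
  \<open>I (rev u)\<close> and is absorbed by \<open>s (z # v)\<close>.\<close>

lemma s_T_Cons: "s [z] \<otimes> T (z # u) v = T u (z # v)"
proof -
  have "s [z] \<otimes> T (z # u) v = R [z] \<otimes> I (rev u) \<otimes> s (z # v)"
    by (simp add: T_def R_def I_def s_append star_mult mult_assoc s_Cons[of z v])
  also have "\<dots> = I (rev u) \<otimes> (R [z] \<otimes> s (z # v))"
    by (simp add: mult_assoc flip: I_R_commute)
  finally show ?thesis by (simp add: R_s_Cons T_eq)
qed

lemma s_T_Cons_neq: assumes "z \<noteq> z'" shows "s [z] \<otimes> T (z' # u) v = \<zero>"
proof -
  have "s [z] \<otimes> T (z' # u) v = s [z] \<otimes> I [z] \<otimes> (I (rev u @ [z']) \<otimes> s v)"
    by (simp add: T_eq s_I)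
  also have "\<dots> = s [z] \<otimes> (I [z] \<otimes> I (rev u @ [z'])) \<otimes> s v"
    by (simp add: mult_assoc)
  also have "I [z] \<otimes> I (rev u @ [z']) = \<zero>"
    using assms by (auto simp: I_mult suffix_def append_eq_Cons_conv Cons_eq_append_conv)
  finally show ?thesis by simp
qed

lemma star_s_T_Cons: "star A (s [z]) \<otimes> T u (z # v) = T (z # u) v"
  by (simp add: T_def s_append star_mult mult_assoc s_Cons[of z v])

lemma star_s_T_Cons_neq: assumes "z \<noteq> z'" shows "star A (s [z]) \<otimes> T u (z' # v) = \<zero>"
proof -
  have "star A (s [z]) \<otimes> T u (z' # v) =
      star A (s [z]) \<otimes> R [z] \<otimes> (I (rev u) \<otimes> (R (z' # v) \<otimes> s (z' # v)))"
    by (simp add: T_eq R_s star_s_R)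
  also have "\<dots> = star A (s [z]) \<otimes> (R [z] \<otimes> I (rev u) \<otimes> R (z' # v)) \<otimes> s (z' # v)"
    by (simp add: mult_assoc)
  also have "R [z] \<otimes> I (rev u) \<otimes> R (z' # v) = I (rev u) \<otimes> (R [z] \<otimes> R (z' # v))"
    by (simp add: mult_assoc flip: I_R_commute)
  also have "R [z] \<otimes> R (z' # v) = \<zero>"
    using assms by (simp add: R_mult)
  finally show ?thesis by simp
qed

fun ev_letter :: "letter \<Rightarrow> 'a" where
  "ev_letter (z, False) = s [z]"
| "ev_letter (z, True) = star A (s [z])"

text \<open>The empty word evaluates to the projection \<open>s []\<close>, since the algebra need
  not have a unit; every letter absorbs it on both sides.\<close>

fun ev :: "word \<Rightarrow> 'a" where
  "ev [] = s []"
| "ev (l # w) = ev_letter l \<otimes> ev w"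

lemma ev_letter_closed [simp]: "ev_letter l \<in> carrier A"
  by (cases l; cases "snd l") auto

lemma ev_closed [simp]: "ev w \<in> carrier A"
  by (induction w) auto

lemma ev_letter_Nil: "s [] \<otimes> ev_letter l = ev_letter l" "ev_letter l \<otimes> s [] = ev_letter l"
  by (cases l; cases "snd l"; simp)+

lemma ev_Nil_left: "s [] \<otimes> ev w = ev w"
  by (cases w) (simp_all add: ev_letter_Nil flip: mult_assoc)

lemma ev_append: "ev (w @ w') = ev w \<otimes> ev w'"
  by (induction w) (auto simp: ev_Nil_left mult_assoc)

lemma ev_letter_inv: "ev_letter (inv_letter l) = star A (ev_letter l)"
  by (cases l; cases "snd l") (auto simp: inv_letter_def)

lemma ev_wstar: "ev (wstar w) = star A (ev w)"
  by (induction w) (auto simp: wstar_def ev_append star_s_Nil ev_letter_inv star_mult mult_assoc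
      ev_letter_Nil simp flip: ev_letter_inv)

lemma ev_pos_word: "ev (pos_word xs) = s xs"
  by (induction xs) (auto simp: pos_word_def simp flip: s_Cons)

subsection \<open>Normal forms of words\<close>

text \<open>The word \<open>rev a @ b\<close> is the shortest one on which \<open>w\<close> can act,
  with the cut going from \<open>(a, b)\<close> to \<open>(u, v)\<close>; longer words are acted on
  in the same place. A further letter moves the cut inside this word, clashes with the adjacent
  letter and gives zero, or, if the cut has reached an end, enlarges the word. The second
  alternative does not claim that \<open>ev w\<close> is nonzero, since the representation may
  vanish on that word.\<close>

lemma ev_normal_form:
  "(ev w = \<zero> \<and> (\<forall>y x. \<not> moves w y x)) \<or>
   (\<exists>u v a b. ev w = T u v \<otimes> star A (T a b) \<and> rev u @ v = rev a @ b \<and>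
      int (length v) = int (length b) + deg w \<and>
      (\<forall>y x. moves w y x \<longleftrightarrow> (\<exists>p q. y = (a @ p, b @ q) \<and> x = (u @ p, v @ q))))"
proof (induction w)
  case Nil
  have "T [] [] \<otimes> star A (T [] []) = s []"
    by (simp add: T_def star_s_Nil)
  then show ?case
    by (intro disjI2 exI[of _ "[]"]) auto
next
  case (Cons l w)
  show ?case
  proof (cases "ev w = \<zero> \<and> (\<forall>y x. \<not> moves w y x)")
    case True
    then show ?thesis by simp
  next
    case False
    then obtain u v a b where ev: "ev w = T u v \<otimes> star A (T a b)" and uv: "rev u @ v = rev a @ b"
      and deg: "int (length v) = int (length b) + deg w"
      and mv: "\<And>y x. moves w y x \<longleftrightarrow> (\<exists>p q. y = (a @ p, b @ q) \<and> x = (u @ p, v @ q))"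
      using Cons.IH by blast
    obtain z bb where l: "l = (z, bb)" by (cases l) auto
    have ev_l: "ev (l # w) = (ev_letter l \<otimes> T u v) \<otimes> star A (T a b)"
      by (simp add: ev mult_assoc)
    show ?thesis
    proof (cases bb)
      case False
      show ?thesis
      proof (cases u)
        case Nil
        \<comment> \<open>The cut is at the left end, so \<open>z\<close> is added in front of the
          word. For it to appear in the right factor too, \<open>I [z]\<close> is inserted after
          \<open>s [z]\<close> and commuted past \<open>R v\<close>.\<close>
        have "ev (l # w) = s [z] \<otimes> s v \<otimes> (star A (s (rev a @ b)) \<otimes> s (rev a))"
          using Nil l False unfolding ev_l by (simp add: T_def star_mult star_s_Nil)
        also have "\<dots> = s [z] \<otimes> R v \<otimes> s (rev a)"
          using uv Nil by (simp add: R_def mult_assoc)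
        also have "\<dots> = s [z] \<otimes> (I [z] \<otimes> R v) \<otimes> s (rev a)"
          by (simp add: s_I flip: mult_assoc)
        also have "\<dots> = s [z] \<otimes> (R v \<otimes> I [z]) \<otimes> s (rev a)"
          by (simp only: I_R_commute)
        also have "\<dots> = T [] (z # v) \<otimes> star A (T (a @ [z]) b)"
          using uv Nil unfolding T_Nil by (simp add: T_def star_mult R_def I_def mult_assoc s_Cons[of z "rev a"]
              s_Cons[of z v] s_Cons[of z "rev a @ b"])
        finally have 1: "ev (l # w) = T [] (z # v) \<otimes> star A (T (a @ [z]) b)" .
        have 2: "moves (l # w) y x \<longleftrightarrow> (\<exists>p q. y = ((a @ [z]) @ p, b @ q) \<and> x = ([] @ p, (z # v) @ q))"
          for y x using l False Nil by (auto simp: mv)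
        have 3: "rev ([]) @ (z # v) = rev (a @ [z]) @ (b)"
            "int (length (z # v)) = int (length (b)) + deg (l # w)"
            using uv deg Nil l False by auto
          show ?thesis
            by (rule disjI2, intro exI conjI allI) (rule 1 2 3)+
      next
        case (Cons z' u')
        show ?thesis
        proof (cases "z = z'")
          case True
          have 1: "ev (l # w) = T u' (z # v) \<otimes> star A (T a b)"
            using Cons l False True unfolding ev_l by (simp add: s_T_Cons)
          have 2: "moves (l # w) y x \<longleftrightarrow> (\<exists>p q. y = (a @ p, b @ q) \<and> x = (u' @ p, (z # v) @ q))"
            for y x using l False Cons True by (auto simp: mv)
          have 3: "rev (u') @ (z # v) = rev (a) @ (b)"
            "int (length (z # v)) = int (length (b)) + deg (l # w)"
            using uv deg Cons l False True by auto
          show ?thesis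
            by (rule disjI2, intro exI conjI allI) (rule 1 2 3)+
        next
          case neq: False
          then have "ev (l # w) = \<zero>"
            unfolding ev_l using Cons l False by (simp add: s_T_Cons_neq)
          moreover have "\<not> moves (l # w) y x" for y x
            using neq Cons l False by (auto simp: mv)
          ultimately show ?thesis by blast
        qed
      qed
    next
      case True
      show ?thesis
      proof (cases v)
        case Nil
        \<comment> \<open>The cut is at the right end, so \<open>z\<close> is appended to the word.
          The new left factor \<open>T (z # u) []\<close> is the initial projection
          \<open>I (rev u @ [z])\<close>, which the adjoint absorbs.\<close>
        have "ev (l # w) = star A (s [z]) \<otimes> (I (rev u) \<otimes> star A (s (rev u))) \<otimes> s (rev a)"
          using Nil l True uv unfolding ev_l by (simp add: T_def I_def star_mult mult_assoc)
        also have "\<dots> = star A (s (rev u @ [z])) \<otimes> s (rev a)"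
          by (simp add: I_star_s s_append star_mult)
        also have "\<dots> = I (rev u @ [z]) \<otimes> star A (s (rev u @ [z])) \<otimes> s (rev a)"
          by (simp only: I_star_s)
        also have "\<dots> = T (z # u) [] \<otimes> star A (T a (b @ [z]))"
          using uv Nil by (simp add: T_def star_mult I_def mult_assoc flip: append_assoc)
        finally have 1: "ev (l # w) = T (z # u) [] \<otimes> star A (T a (b @ [z]))" .
        have 2: "moves (l # w) y x \<longleftrightarrow> (\<exists>p q. y = (a @ p, (b @ [z]) @ q) \<and> x = ((z # u) @ p, [] @ q))"
          for y x using l True Nil by (auto simp: mv)
        have 3: "rev (z # u) @ ([]) = rev (a) @ (b @ [z])"
            "int (length ([])) = int (length (b @ [z])) + deg (l # w)"
            using uv deg Nil l True by auto
          show ?thesis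
            by (rule disjI2, intro exI conjI allI) (rule 1 2 3)+
      next
        case (Cons z' v')
        show ?thesis
        proof (cases "z = z'")
          case eq: True
          have 1: "ev (l # w) = T (z # u) v' \<otimes> star A (T a b)"
            using Cons l True eq unfolding ev_l by (simp add: star_s_T_Cons)
          have 2: "moves (l # w) y x \<longleftrightarrow> (\<exists>p q. y = (a @ p, b @ q) \<and> x = ((z # u) @ p, v' @ q))"
            for y x using l True Cons eq by (auto simp: mv)
          have 3: "rev (z # u) @ (v') = rev (a) @ (b)"
            "int (length (v')) = int (length (b)) + deg (l # w)"
            using uv deg Cons l True eq by auto
          show ?thesis
            by (rule disjI2, intro exI conjI allI) (rule 1 2 3)+
        next
          case neq: False
          then have "ev (l # w) = \<zero>"
            unfolding ev_l using Cons l True by (simp add: star_s_T_Cons_neq)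
          moreover have "\<not> moves (l # w) y x" for y x
            using neq Cons l True by (auto simp: mv)
          ultimately show ?thesis by blast
        qed
      qed
    qed
  qed
qed

text \<open>The two cuts in the normal form belong to one word; in degree zero their right halves
  have equal length, so the cuts coincide.\<close>

lemma ev_deg_zero:
  assumes "deg w = 0"
  shows "(ev w = \<zero> \<and> (\<forall>y x. \<not> moves w y x)) \<or>
    (\<exists>z. ev w = P z \<and> (\<forall>y x. moves w y x \<longleftrightarrow> x = y \<and> zle z y))"
proof (cases "ev w = \<zero> \<and> (\<forall>y x. \<not> moves w y x)")
  case False
  then obtain u v a b where ev: "ev w = T u v \<otimes> star A (T a b)" and uv: "rev u @ v = rev a @ b"
    and "length v = length b"
    and mv: "\<And>y x. moves w y x \<longleftrightarrow> (\<exists>p q. y = (a @ p, b @ q) \<and> x = (u @ p, v @ q))"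
    using ev_normal_form[of w] assms by auto
  then have eq: "a = u" "b = v" by auto
  have "ev w = I (rev u) \<otimes> R v \<otimes> I (rev u)"
    by (simp add: ev eq T_eq star_mult I_star R_def mult_assoc)
  also have "\<dots> = I (rev u) \<otimes> (I (rev u) \<otimes> R v)"
    by (simp add: mult_assoc flip: I_R_commute)
  also have "\<dots> = P (u, v)"
    by (simp add: P_def proj_idem[OF proj_I] flip: mult_assoc)
  finally show ?thesis
    by (intro disjI2 exI[of _ "(u, v)"]) (auto simp: mv eq zle_def prefix_def)
qed auto

end

section \<open>Noncommutative polynomials\<close>

type_synonym npoly = "(complex \<times> word) list"

text \<open>\<open>coef p y x\<close> is the entry in row \<open>x\<close> and column \<open>y\<close> of the operator by which \<open>p\<close> acts on
  \<open>\<ell>\<^sup>2\<close> of the set of zippers.\<close>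

fun coef :: "npoly \<Rightarrow> zipper \<Rightarrow> zipper \<Rightarrow> complex" where
  "coef [] y x = 0"
| "coef ((a, w) # p) y x = (if moves w y x then a else 0) + coef p y x"

definition pscale :: "complex \<Rightarrow> npoly \<Rightarrow> npoly" where
  "pscale c p = map (\<lambda>(a, w). (c * a, w)) p"

definition pstar :: "npoly \<Rightarrow> npoly" where
  "pstar p = map (\<lambda>(a, w). (cnj a, wstar w)) p"

definition pmonom_mult :: "complex \<Rightarrow> word \<Rightarrow> npoly \<Rightarrow> npoly" where
  "pmonom_mult a w q = map (\<lambda>(b, w'). (a * b, w @ w')) q"

fun pmult :: "npoly \<Rightarrow> npoly \<Rightarrow> npoly" where
  "pmult [] q = []"
| "pmult ((a, w) # p) q = pmonom_mult a w q @ pmult p q"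

fun psq_iter :: "npoly \<Rightarrow> nat \<Rightarrow> npoly" where
  "psq_iter p 0 = p"
| "psq_iter p (Suc k) = pmult (pstar (psq_iter p k)) (psq_iter p k)"

definition plength :: "npoly \<Rightarrow> nat \<Rightarrow> bool" where
  "plength p L \<longleftrightarrow> (\<forall>(a, w)\<in>set p. length w \<le> L)"

lemma mem_pmult_iff:
  "x \<in> set (pmult p q) \<longleftrightarrow>
     (\<exists>a w b w'. (a, w) \<in> set p \<and> (b, w') \<in> set q \<and> x = (a * b, w @ w'))"
proof (induction p q rule: pmult.induct)
  case (2 a w p q)
  have "x \<in> set (pmonom_mult a w q) \<longleftrightarrow> (\<exists>b w'. (b, w') \<in> set q \<and> x = (a * b, w @ w'))"
    by (auto simp: pmonom_mult_def image_iff split_beta Bex_def)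
  then show ?case
    unfolding pmult.simps set_append Un_iff 2 list.set insert_iff prod.inject by blast
qed simp

lemma set_pstar: "set (pstar p) = (\<lambda>(a, w). (cnj a, wstar w)) ` set p"
  by (simp add: pstar_def)

lemma plength_pstar: "plength p L \<Longrightarrow> plength (pstar p) L"
  by (auto simp: plength_def set_pstar)

lemma plength_pmult: "plength p L \<Longrightarrow> plength q L' \<Longrightarrow> plength (pmult p q) (L + L')"
  unfolding plength_def by (fastforce simp: mem_pmult_iff intro: add_mono)

lemma plength_psq_iter: "plength p L \<Longrightarrow> plength (psq_iter p k) (L * 2 ^ k)"
proof (induction k)
  case (Suc k)
  then show ?case
    using plength_pmult[OF plength_pstar[of "psq_iter p k" "L * 2 ^ k"], of "psq_iter p k" "L * 2 ^ k"]
    by (simp add: mult.left_commute flip: mult_2)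
qed simp

lemma plength_ex: "\<exists>L. plength p L"
proof
  show "plength p (sum_list (map (length \<circ> snd) p))"
    unfolding plength_def by (force intro: member_le_sum_list)
qed

text \<open>In general an entry of a product is a sum over intermediate cuts. The hypothesis leaves
  \<open>m0\<close> as the only one; it holds for homogeneous \<open>q\<close> by
  \<open>moves_unique\<close>.\<close>

lemma coef_pmonom_mult:
  assumes "\<And>b w' m. (b, w') \<in> set q \<Longrightarrow> moves w' y m \<Longrightarrow> m = m0"
  shows "coef (pmonom_mult a w q) y x = (if moves w m0 x then a else 0) * coef q y m0"
  using assms
proof (induction q)
  case (Cons bw q)
  obtain b w' where bw: "bw = (b, w')" by (cases bw) auto
  have "moves (w @ w') y x \<longleftrightarrow> moves w' y m0 \<and> moves w m0 x"
    unfolding moves_append using Cons.prems[of b w'] bw by (metis list.set_intros(1))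
  moreover have "coef (pmonom_mult a w q) y x = (if moves w m0 x then a else 0) * coef q y m0"
    using Cons by (meson list.set_intros(2))
  moreover have "pmonom_mult a w (bw # q) = (a * b, w @ w') # pmonom_mult a w q"
    by (simp add: pmonom_mult_def bw)
  ultimately show ?case by (simp add: bw algebra_simps)
qed (simp add: pmonom_mult_def)

lemma coef_pmult_pstar:
  assumes "\<And>b w' m. (b, w') \<in> set q \<Longrightarrow> moves w' y m \<Longrightarrow> m = m0"
  shows "coef (pmult (pstar p) q) y x = cnj (coef p x m0) * coef q y m0"
proof (induction p)
  case (Cons aw p)
  have app: "coef (p @ q) y x = coef p y x + coef q y x" for p q
    by (induction p) (auto simp: add.assoc)
  show ?case
    using Cons by (cases aw)
      (auto simp: pstar_def app coef_pmonom_mult[OF assms] moves_wstar algebra_simps)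
qed (simp add: pstar_def)

text \<open>The position of an entry reveals the degree of the words contributing to it. Taking a
  homogeneous part therefore masks entries and cannot enlarge any of them.\<close>

lemma coef_filter_deg:
  "coef (filter (\<lambda>(a, w). deg w = d) p) y x =
     (if int (length (snd x)) = int (length (snd y)) + d then coef p y x else 0)"
proof (induction p)
  case (Cons aw p)
  have "int (length (snd x)) = int (length (snd y)) + deg w" if "moves w y x" for w
    using moves_invariant[OF that] by simp
  then show ?case using Cons by (cases aw) auto
qed simp

section \<open>Evaluation of polynomials in a representation\<close>

context bicovariant_representation
begin

fun evp :: "npoly \<Rightarrow> 'a" where
  "evp [] = \<zero>"
| "evp ((a, w) # p) = scale A a (ev w) \<oplus> evp p"

lemma evp_closed [simp]: "evp p \<in> carrier A"
  by (induction p rule: evp.induct) auto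

lemma evp_append: "evp (p @ q) = evp p \<oplus> evp q"
  by (induction p rule: evp.induct) (auto simp: a_assoc)

lemma evp_pscale: "evp (pscale c p) = scale A c (evp p)"
  by (induction p rule: evp.induct) (auto simp: pscale_def scale_add_right scale_scale)

lemma evp_pstar: "evp (pstar p) = star A (evp p)"
  by (induction p rule: evp.induct) (auto simp: pstar_def star_add star_scale ev_wstar)

lemma evp_pmonom_mult: "evp (pmonom_mult a w q) = scale A a (ev w) \<otimes> evp q"
  by (induction q rule: evp.induct)
    (auto simp: pmonom_mult_def distrib_left mult_scale_left mult_scale_right scale_scale
      scale_add_right ev_append mult.commute)

lemma evp_pmult: "evp (pmult p q) = evp p \<otimes> evp q"
  by (induction p rule: evp.induct) (auto simp: evp_append evp_pmonom_mult distrib_right)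

lemma evp_psq_iter: "evp (psq_iter p k) = sq_iter (evp p) k"
  by (induction k) (auto simp: evp_pmult evp_pstar)

lemma evp_Nil_right: "evp p \<otimes> s [] = evp p"
proof -
  have "ev w \<otimes> s [] = ev w" for w
    using ev_append[of w "[]"] by simp
  then show ?thesis
    by (induction p rule: evp.induct) (auto simp: distrib_right mult_scale_left)
qed

lemma evp_filter:
  "evp p = evp (filter Q p) \<oplus> evp (filter (\<lambda>x. \<not> Q x) p)"
  by (induction p rule: evp.induct) (auto simp: a_ac)

subsection \<open>The matrix coefficients bound the norm from below\<close>

text \<open>For a letter \<open>c\<close> that does not occur in a polynomial, the elements \<open>ket c y\<close> behave like
  the vectors of an orthonormal basis indexed by zippers: left multiplication by a word moves
  the cut or kills the element. The end markers \<open>c\<close> stop the cut at the ends of the word.\<close>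

definition ket :: "nat \<Rightarrow> zipper \<Rightarrow> 'a" where
  "ket c y = T (fst y @ [c]) (snd y @ [c])"

lemma ket_closed [simp]: "ket c y \<in> carrier A"
  by (simp add: ket_def)

text \<open>At an end of the word the adjacent letter is the marker \<open>c\<close>. It differs
  from the letter of \<open>l\<close>, so the product vanishes exactly where \<open>move\<close> is
  undefined.\<close>

lemma ev_letter_ket:
  assumes "fst l \<noteq> c"
  shows "(\<exists>x. move l y x \<and> ev_letter l \<otimes> ket c y = ket c x) \<or>
    (\<forall>x. \<not> move l y x) \<and> ev_letter l \<otimes> ket c y = \<zero>"
proof -
  obtain z b where l: "l = (z, b)" by (cases l)
  obtain u v where y: "y = (u, v)" by (cases y)
  show ?thesis
  proof (cases b)
    case False
    show ?thesis
    proof (cases u)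
      case Nil
      then show ?thesis using assms False by (simp add: l y ket_def s_T_Cons_neq)
    next
      case (Cons z' u')
      then show ?thesis using False
        by (cases "z = z'") (auto simp: l y ket_def s_T_Cons_neq s_T_Cons)
    qed
  next
    case True
    show ?thesis
    proof (cases v)
      case Nil
      then show ?thesis using assms True by (simp add: l y ket_def star_s_T_Cons_neq)
    next
      case (Cons z' v')
      then show ?thesis using True
        by (cases "z = z'") (auto simp: l y ket_def star_s_T_Cons_neq star_s_T_Cons)
    qed
  qed
qed

lemma ev_ket:
  assumes "c \<notin> fst ` set w"
  shows "(\<exists>x. moves w y x \<and> ev w \<otimes> ket c y = ket c x) \<or>
    (\<forall>x. \<not> moves w y x) \<and> ev w \<otimes> ket c y = \<zero>"
  using assms
proof (induction w)
  case Nil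
  have "s [] \<otimes> T u v = T u v" for u v
    by (simp add: T_def flip: mult_assoc)
  then show ?case by (simp add: ket_def)
next
  case (Cons l w)
  have *: "ev (l # w) \<otimes> ket c y = ev_letter l \<otimes> (ev w \<otimes> ket c y)"
    by (simp add: mult_assoc)
  from Cons consider (move) m where "moves w y m" "ev w \<otimes> ket c y = ket c m"
    | (zero) "\<forall>x. \<not> moves w y x" "ev w \<otimes> ket c y = \<zero>"
    by auto
  then show ?case
  proof cases
    case move
    have "m' = m" if "moves w y m'" for m'
      using that move(1) moves_unique by blast
    then have eq: "moves (l # w) y x \<longleftrightarrow> move l m x" for x
      using move(1) unfolding moves.simps by blast
    show ?thesis
      using ev_letter_ket[of l c m] Cons.prems unfolding * eq move(2) by simp
  next
    case zero
    then show ?thesis unfolding * by simp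
  qed
qed

lemma ket_eq: "ket c (u, v) = I (c # rev u) \<otimes> s (v @ [c])"
  by (simp add: ket_def T_eq)

lemma R_I_left_commute: "x \<in> carrier A \<Longrightarrow> R ys \<otimes> (I xs \<otimes> x) = I xs \<otimes> (R ys \<otimes> x)"
  by (simp add: I_R_commute flip: mult_assoc)

text \<open>As \<open>c\<close> occurs only as an end marker, neither of two distinct words
  \<open>c # rev u\<close> is a suffix of the other, and neither of two distinct words
  \<open>v @ [c]\<close> is a prefix of the other. So distinct cuts have orthogonal initial
  projections on the left or orthogonal range projections on the right.\<close>

lemma ket_orthogonal:
  assumes "c \<notin> set (rev (fst x) @ snd x)" "c \<notin> set (rev (fst y) @ snd y)" "x \<noteq> y"
  shows "star A (ket c x) \<otimes> ket c y = \<zero>"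
proof -
  obtain u v u' v' where xy: "x = (u, v)" "y = (u', v')" by (cases x; cases y)
  have eq: "star A (ket c x) \<otimes> ket c y =
      star A (s (v @ [c])) \<otimes> (I (c # rev u) \<otimes> I (c # rev u')) \<otimes> s (v' @ [c])"
    by (simp add: xy ket_eq star_mult I_star mult_assoc)
  show ?thesis
  proof (cases "u = u'")
    case False
    then have "I (c # rev u) \<otimes> I (c # rev u') = \<zero>"
      using assms by (auto simp: xy I_mult suffix_Cons dest: set_mono_suffix)
    then show ?thesis by (simp add: eq)
  next
    case True
    have "star A (ket c x) \<otimes> ket c y =
        (star A (s (v @ [c])) \<otimes> R (v @ [c])) \<otimes> I (c # rev u) \<otimes> (R (v' @ [c]) \<otimes> s (v' @ [c]))"
      by (simp add: eq True proj_idem[OF proj_I] R_s star_s_R)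
    also have "\<dots> = star A (s (v @ [c])) \<otimes> I (c # rev u) \<otimes> (R (v @ [c]) \<otimes> R (v' @ [c])) \<otimes> s (v' @ [c])"
      by (simp add: mult_assoc R_I_left_commute)
    also have "R (v @ [c]) \<otimes> R (v' @ [c]) = \<zero>"
      using assms True by (auto simp: xy R_mult prefix_snoc dest: set_mono_prefix)
    finally show ?thesis by simp
  qed
qed

text \<open>The square of the ket is the initial projection of the whole marked word
  \<open>c # rev u @ v @ [c]\<close>; this is where the nonvanishing of the representation enters
  the estimate.\<close>

lemma ket_norm: 
  assumes "\<And>xs. s xs \<noteq> \<zero>"
  shows "cnorm A (ket c y) = 1" "cnorm A (star A (ket c y) \<otimes> ket c y) = 1"
proof -
  obtain u v where y: "y = (u, v)" by (cases y)
  have "star A (ket c y) \<otimes> ket c y =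
      star A (s (v @ [c])) \<otimes> (I (c # rev u) \<otimes> I (c # rev u)) \<otimes> s (v @ [c])"
    by (simp add: y ket_eq star_mult I_star mult_assoc)
  also have "\<dots> = star A (s ((c # rev u) @ v @ [c])) \<otimes> s ((c # rev u) @ v @ [c])"
    unfolding proj_idem[OF proj_I] s_append[of "c # rev u" "v @ [c]"]
    by (simp add: I_def star_mult mult_assoc)
  finally have "cnorm A (star A (ket c y) \<otimes> ket c y) = (cnorm A (s ((c # rev u) @ v @ [c])))\<^sup>2"
    using cstar_identity by simp
  then show *: "cnorm A (star A (ket c y) \<otimes> ket c y) = 1"
    using partial_isometry_norm[OF s_partial_isometry assms] by simp
  then show "cnorm A (ket c y) = 1"
    using cstar_identity[of "ket c y"] abs_square_eq_1[of "cnorm A (ket c y)"] by simp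
qed

lemma coef_le_norm:
  assumes nz: "\<And>xs. s xs \<noteq> \<zero>"
  shows "cmod (coef p y x) \<le> cnorm A (evp p)"
proof -
  \<comment> \<open>Here the infinity of the generators is used: some letter occurs neither in
    \<open>p\<close> nor in the two words being cut.\<close>
  have "finite ((\<Union>(a, w)\<in>set p. fst ` set w) \<union> set (rev (fst x) @ snd x) \<union> set (rev (fst y) @ snd y))"
    by (auto simp: split_beta)
  from ex_new_if_finite[OF infinite_UNIV_nat this]
  obtain c where c: "\<And>a w. (a, w) \<in> set p \<Longrightarrow> c \<notin> fst ` set w"
    and cx: "c \<notin> set (rev (fst x) @ snd x)" and cy: "c \<notin> set (rev (fst y) @ snd y)"
    by fastforce
  let ?N = "star A (ket c x) \<otimes> ket c x"
  have word: "star A (ket c x) \<otimes> (ev w \<otimes> ket c y) = (if moves w y x then ?N else \<zero>)"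
    if "c \<notin> fst ` set w" for w
  proof -
    from ev_ket[OF that, of y] consider (move) m where "moves w y m" "ev w \<otimes> ket c y = ket c m"
      | (zero) "\<forall>x. \<not> moves w y x" "ev w \<otimes> ket c y = \<zero>"
      by auto
    then show ?thesis
    proof cases
      case zero
      then show ?thesis by (simp del: split_paired_All)
    next
      case move
      have "moves w y x \<longleftrightarrow> m = x"
        using move(1) moves_unique by blast
      moreover have "c \<notin> set (rev (fst m) @ snd m)"
        using moves_invariant[OF move(1)] cy by simp
      ultimately show ?thesis
        using move(2) ket_orthogonal[OF cx, of m] by auto
    qed
  qed
  have "star A (ket c x) \<otimes> (evp p \<otimes> ket c y) = scale A (coef p y x) ?N"
    using c
  proof (induction p rule: evp.induct)
    case (2 a w p)
    then have "c \<notin> fst ` set w"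
      and "star A (ket c x) \<otimes> (evp p \<otimes> ket c y) = scale A (coef p y x) ?N"
      by (force, meson list.set_intros(2))
    then show ?case
      by (simp add: distrib_left distrib_right mult_scale_left mult_scale_right word scale_add_left)
  qed simp
  then have "cmod (coef p y x) = cnorm A (star A (ket c x) \<otimes> (evp p \<otimes> ket c y))"
    by (simp add: norm_scale ket_norm(2)[OF nz])
  also have "\<dots> \<le> cnorm A (star A (ket c x)) * cnorm A (evp p \<otimes> ket c y)"
    by (intro norm_mult) auto
  also have "\<dots> \<le> cnorm A (evp p)"
    using norm_mult[of "evp p" "ket c y"] by (simp add: ket_norm[OF nz])
  finally show ?thesis .
qed

end

context bicovariant_representation
begin

subsection \<open>The matrix coefficients bound the norm from above\<close>

lemma evp_deg_zero_commute:
  assumes "\<And>a w. (a, w) \<in> set p \<Longrightarrow> deg w = 0"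
    and r: "r \<in> carrier A" "\<And>z. P z \<otimes> r = r \<otimes> P z"
  shows "evp p \<otimes> r = r \<otimes> evp p"
  using assms(1)
proof (induction p rule: evp.induct)
  case (2 a w p)
  have "ev w \<otimes> r = r \<otimes> ev w"
  proof -
    have "deg w = 0" using 2(2)[of a w] by simp
    then have "ev w = \<zero> \<or> (\<exists>z. ev w = P z)" using ev_deg_zero by blast
    then show ?thesis using r by auto
  qed
  moreover have "evp p \<otimes> r = r \<otimes> evp p"
    using 2 by (meson list.set_intros(2))
  ultimately show ?case
    using r(1) by (simp add: distrib_left distrib_right mult_scale_left mult_scale_right)
qed (use r in simp)

text \<open>A combination of the commuting projections \<open>P z\<close> is diagonalized by splitting \<open>r\<close> into
  \<open>r P z\<close> and \<open>r - r P z\<close>, one projection at a time.\<close>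

lemma norm_deg_zero_aux:
  assumes "\<And>a w. (a, w) \<in> set p \<Longrightarrow> deg w = 0" "0 \<le> M"
    and "proj r" "\<And>z. P z \<otimes> r = r \<otimes> P z" "P y \<otimes> r = r"
    and "\<And>x. zle y x \<Longrightarrow> P x \<otimes> r \<noteq> \<zero> \<Longrightarrow> cmod (t + coef p x x) \<le> M"
  shows "cnorm A (scale A t r \<oplus> evp p \<otimes> r) \<le> M"
  using assms
proof (induction p arbitrary: t r y rule: evp.induct)
  \<comment> \<open>\<open>t\<close> collects the coefficients already decided on \<open>r\<close>,
    and \<open>r\<close> lies below \<open>P y\<close>; the bound is assumed only at cuts that
    extend \<open>y\<close> and meet \<open>r\<close>. When no monomial is left, \<open>y\<close>
    itself is such a cut unless \<open>r\<close> is zero.\<close>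
  case 1
  show ?case
  proof (cases "r = \<zero>")
    case False
    then have "cmod t \<le> M" using 1(6)[of y] 1(5) by simp
    then show ?thesis using 1 False by (simp add: norm_scale proj_norm)
  qed (use 1 in simp)
next
  case (2 a w p)
  have r: "r \<in> carrier A" using \<open>proj r\<close> by simp
  have deg: "deg w = 0" "\<And>a w. (a, w) \<in> set p \<Longrightarrow> deg w = 0"
    using 2(2) by auto
  from ev_deg_zero[OF deg(1)] show ?case
  proof
    assume "ev w = \<zero> \<and> (\<forall>y x. \<not> moves w y x)"
    then have "ev w = \<zero>" and nm: "\<not> moves w y x" for y x by blast+
    moreover have "cnorm A (scale A t r \<oplus> evp p \<otimes> r) \<le> M"
      using 2(1)[OF deg(2) 2(3-6)] 2(7) by (simp add: nm)
    ultimately show ?thesis by simp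
  next
    assume "\<exists>z. ev w = P z \<and> (\<forall>y x. moves w y x \<longleftrightarrow> x = y \<and> zle z y)"
    then obtain z where z: "ev w = P z" and mv: "\<And>y x. moves w y x \<longleftrightarrow> x = y \<and> zle z y"
      by blast
    define r1 where "r1 = r \<otimes> P z"
    define r2 where "r2 = r \<ominus> r \<otimes> P z"
    have c: "r1 \<in> carrier A" "r2 \<in> carrier A"
      using r by (auto simp: r1_def r2_def)
    have rP: "r \<otimes> P z = P z \<otimes> r" using 2(5) by simp
    have p1: "proj r1" unfolding r1_def by (intro proj_mult \<open>proj r\<close> proj_P rP)
    have p2: "proj r2" unfolding r2_def by (intro proj_minus \<open>proj r\<close> proj_P rP)
    have com1: "P x \<otimes> r1 = r1 \<otimes> P x" for x
    proof -
      have "P x \<otimes> r1 = (P x \<otimes> r) \<otimes> P z" using r by (simp add: r1_def mult_assoc)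
      also have "\<dots> = r \<otimes> (P x \<otimes> P z)" using r 2(5) by (simp add: mult_assoc)
      also have "\<dots> = r \<otimes> (P z \<otimes> P x)" by (simp only: P_commute)
      finally show ?thesis using r by (simp add: r1_def mult_assoc)
    qed
    have com2: "P x \<otimes> r2 = r2 \<otimes> P x" for x
      using com1[of x] r c(1) 2(5)[of x]
      by (simp add: r2_def l_distrib_minus r_distrib_minus flip: r1_def)
    have r12: "r1 \<oplus> r2 = r"
      using r c unfolding r2_def r1_def[symmetric]
      by (simp add: minus_eq_scale) (metis a_comm a_inv_eq_scale a_lcomm r_neg r_zero scale_closed)
    have idem: "r \<otimes> r = r" "P z \<otimes> P z = P z"
      using \<open>proj r\<close> proj_P by (auto simp: proj_idem)
    have Pz1: "P z \<otimes> r1 = r1"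
      using r idem by (simp add: r1_def rP flip: mult_assoc)
    have Pz2: "P z \<otimes> r2 = \<zero>"
      using r c(1) Pz1 by (simp add: r2_def r_distrib_minus flip: rP r1_def)
    have orth: "r1 \<otimes> r2 = \<zero>" "r2 \<otimes> r1 = \<zero>"
    proof -
      have "r1 \<otimes> r2 = r1 \<otimes> P z \<otimes> r2" using Pz1 com1 by metis
      then show "r1 \<otimes> r2 = \<zero>" using c Pz2 by (simp add: mult_assoc)
      have "r2 \<otimes> r1 = r2 \<otimes> P z \<otimes> r1" using c Pz1 by (simp add: mult_assoc)
      also have "r2 \<otimes> P z = \<zero>" using com2[of z] Pz2 by simp
      finally show "r2 \<otimes> r1 = \<zero>" using c by simp
    qed
    \<comment> \<open>On \<open>r1\<close> the projection \<open>P z\<close> acts as the identity,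
      so \<open>a\<close> joins \<open>t\<close>; on \<open>r2\<close> it acts as zero, so
      \<open>a\<close> disappears.\<close>
    define X1 where "X1 = scale A (t + a) r1 \<oplus> evp p \<otimes> r1"
    define X2 where "X2 = scale A t r2 \<oplus> evp p \<otimes> r2"
    have X: "X1 \<in> carrier A" "X2 \<in> carrier A" using c by (auto simp: X1_def X2_def)
    have E1: "evp p \<otimes> r1 = r1 \<otimes> evp p"
      by (rule evp_deg_zero_commute[OF deg(2) c(1) com1])
    have E2: "evp p \<otimes> r2 = r2 \<otimes> evp p"
      by (rule evp_deg_zero_commute[OF deg(2) c(2) com2])
    have X1r: "X1 = r1 \<otimes> X1" "X1 = X1 \<otimes> r1"
      using c proj_idem[OF p1]
      by (simp_all add: X1_def distrib_left distrib_right mult_scale_left mult_scale_right mult_assoc)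
        (simp add: E1 flip: mult_assoc)
    have X2r: "X2 = r2 \<otimes> X2" "X2 = X2 \<otimes> r2"
      using c proj_idem[OF p2]
      by (simp_all add: X2_def distrib_left distrib_right mult_scale_left mult_scale_right mult_assoc)
        (simp add: E2 flip: mult_assoc)
    have "scale A t r \<oplus> evp ((a, w) # p) \<otimes> r =
        scale A t (r1 \<oplus> r2) \<oplus> (scale A a (P z) \<otimes> (r1 \<oplus> r2) \<oplus> evp p \<otimes> (r1 \<oplus> r2))"
      using c r by (simp add: r12 distrib_right z)
    also have "\<dots> = X1 \<oplus> X2"
      using c by (simp add: X1_def X2_def scale_add_right scale_add_left distrib_left
          mult_scale_left Pz1 Pz2 a_ac)
    finally have split: "scale A t r \<oplus> evp ((a, w) # p) \<otimes> r = X1 \<oplus> X2" .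
    \<comment> \<open>\<open>r1\<close> lies below both \<open>P z\<close> and \<open>P y\<close>,
      so these have a nonzero product and a common extension \<open>y'\<close> can replace
      \<open>y\<close>. All cuts beyond \<open>y'\<close> extend \<open>z\<close>, hence the first
      monomial contributes \<open>a\<close> at each of them.\<close>
    have N1: "cnorm A X1 \<le> M"
    proof (cases "r1 = \<zero>")
      case False
      have *: "P z \<otimes> P y \<otimes> r = r1"
        using r 2(6) rP by (simp add: mult_assoc r1_def)
      then have "P z \<otimes> P y \<noteq> \<zero>" using False r by auto
      then obtain y' where y': "zle z y'" "zle y y'" "P z \<otimes> P y = P y'" by (rule P_join)
      have "P y' \<otimes> r1 = (P y' \<otimes> r) \<otimes> P z"
        using r by (simp add: r1_def mult_assoc)
      also have "\<dots> = r1 \<otimes> P z" using * y'(3) by simp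
      also have "\<dots> = r1" using com1 Pz1 by metis
      finally have y'1: "P y' \<otimes> r1 = r1" .
      show ?thesis unfolding X1_def
      proof (rule 2(1)[OF deg(2) 2(3) p1 com1 y'1])
        fix x assume x: "zle y' x" "P x \<otimes> r1 \<noteq> \<zero>"
        have "P x \<otimes> r1 = P x \<otimes> r \<otimes> P z"
          using r by (simp add: r1_def mult_assoc)
        then have "P x \<otimes> r \<noteq> \<zero>" using x(2) by auto
        then have "cmod (t + coef ((a, w) # p) x x) \<le> M"
          using 2(7) x(1) y'(2) zle_trans by blast
        then show "cmod (t + a + coef p x x) \<le> M"
          using zle_trans[OF y'(1) x(1)] by (simp add: mv add.assoc)
      qed
    qed (use \<open>0 \<le> M\<close> in \<open>simp add: X1_def\<close>)
    \<comment> \<open>Here \<open>y\<close> is kept. A cut that meets \<open>r2\<close> cannot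
      extend \<open>z\<close>, because its projection would lie below \<open>P z\<close>; so the
      first monomial contributes nothing there.\<close>
    have N2: "cnorm A X2 \<le> M"
      unfolding X2_def
    proof (rule 2(1)[OF deg(2) 2(3) p2 com2])
      have "P y \<otimes> r1 = r1"
        using r 2(6) by (simp add: r1_def flip: mult_assoc)
      then show "P y \<otimes> r2 = r2"
        using r c(1) 2(6) by (simp add: r2_def r_distrib_minus flip: r1_def)
    next
      fix x assume x: "zle y x" "P x \<otimes> r2 \<noteq> \<zero>"
      have Pxr2: "P x \<otimes> r2 = P x \<otimes> r \<ominus> P x \<otimes> r \<otimes> P z"
        using r by (simp add: r2_def r_distrib_minus mult_assoc)
      then have "P x \<otimes> r \<noteq> \<zero>" using x(2) by auto
      then have *: "cmod (t + coef ((a, w) # p) x x) \<le> M"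
        using 2(7) x(1) by blast
      have "\<not> zle z x"
      proof
        assume "zle z x"
        then have "P z \<otimes> P x = P x" by (rule P_mult_eq)
        have "P x \<otimes> r2 = (P x \<otimes> P z) \<otimes> r2"
          using \<open>P z \<otimes> P x = P x\<close> P_commute by metis
        also have "\<dots> = \<zero>"
          using c by (simp add: mult_assoc Pz2)
        finally show False using x(2) by simp
      qed
      then show "cmod (t + coef p x x) \<le> M"
        using * by (simp add: mv)
    qed
    show ?thesis
      unfolding split
    proof (rule norm_orthogonal_add_le[OF X(1) N1 X(2) N2])
      have "star A X1 \<otimes> X2 = star A (r1 \<otimes> X1) \<otimes> (r2 \<otimes> X2)"
        using X1r X2r by simp
      also have "\<dots> = star A X1 \<otimes> (r1 \<otimes> r2) \<otimes> X2"
        using X c by (simp add: star_mult proj_star[OF p1] mult_assoc)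
      finally show "star A X1 \<otimes> X2 = \<zero>"
        using X by (simp add: orth)
      have "X1 \<otimes> star A X2 = (X1 \<otimes> r1) \<otimes> star A (X2 \<otimes> r2)"
        using X1r X2r by simp
      also have "\<dots> = X1 \<otimes> (r1 \<otimes> r2) \<otimes> star A X2"
        using X c by (simp add: star_mult proj_star[OF p2] mult_assoc)
      finally show "X1 \<otimes> star A X2 = \<zero>"
        using X by (simp add: orth)
    qed
  qed
qed

lemma norm_deg_zero:
  assumes "\<And>a w. (a, w) \<in> set p \<Longrightarrow> deg w = 0" "0 \<le> M" "\<And>x. cmod (coef p x x) \<le> M"
  shows "cnorm A (evp p) \<le> M"
proof -
  \<comment> \<open>The recursion starts at the empty cut, which every cut extends; its projection
    is \<open>s []\<close>, a right unit for \<open>evp p\<close>.\<close>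
  have "cnorm A (scale A 0 (P ([], [])) \<oplus> evp p \<otimes> P ([], [])) \<le> M"
    by (rule norm_deg_zero_aux[where y = "([], [])"])
      (use assms in \<open>auto simp: proj_P P_commute proj_idem[OF proj_P]\<close>)
  then show ?thesis by (simp add: P_Nil evp_Nil_right)
qed

text \<open>\<open>q* q\<close> has degree zero, so only its diagonal entries count. Since a column
  of the matrix of \<open>q\<close> has at most one nonzero entry, each of them is the square of one
  modulus rather than a sum of squares.\<close>

lemma norm_homogeneous:
  assumes deg: "\<And>a w. (a, w) \<in> set q \<Longrightarrow> deg w = d" and "0 \<le> M"
    and M: "\<And>y x. cmod (coef q y x) \<le> M"
  shows "cnorm A (evp q) \<le> M"
proof -
  let ?Q = "pmult (pstar q) q"
  have "cnorm A (evp ?Q) \<le> M\<^sup>2"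
  proof (rule norm_deg_zero)
    fix a w assume "(a, w) \<in> set ?Q"
    then show "deg w = 0"
      using deg by (auto simp: mem_pmult_iff set_pstar deg_append deg_wstar)
  next
    fix x
    obtain m0 where m0: "\<And>b w m. (b, w) \<in> set q \<Longrightarrow> moves w x m \<Longrightarrow> m = m0"
      using moves_unique deg by metis
    have "cmod (coef ?Q x x) = (cmod (coef q x m0))\<^sup>2"
      by (simp add: coef_pmult_pstar[OF m0] Real_Vector_Spaces.norm_mult power2_eq_square)
    also have "\<dots> \<le> M\<^sup>2"
      by (intro power_mono M) simp
    finally show "cmod (coef ?Q x x) \<le> M\<^sup>2" .
  qed simp
  then have "(cnorm A (evp q))\<^sup>2 \<le> M\<^sup>2"
    by (simp add: evp_pmult evp_pstar cstar_identity)
  then show ?thesis using \<open>0 \<le> M\<close> by (rule power2_le_imp_le)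
qed

lemma norm_degrees:
  assumes "\<And>a w. (a, w) \<in> set p \<Longrightarrow> deg w \<in> set ds" "0 \<le> M"
    and "\<And>y x. cmod (coef p y x) \<le> M"
  shows "cnorm A (evp p) \<le> real (length ds) * M"
  using assms
proof (induction ds arbitrary: p)
  case Nil
  then have "p = []" by (cases p) auto
  then show ?case by simp
next
  case (Cons d ds)
  let ?p = "filter (\<lambda>(a, w). deg w = d) p" and ?q = "filter (\<lambda>x. \<not> (case x of (a, w) \<Rightarrow> deg w = d)) p"
  have app: "coef p y x = coef ?p y x + coef ?q y x" for y x
    by (induction p) auto
  have "cnorm A (evp ?p) \<le> M"
    using Cons.prems by (intro norm_homogeneous[where d = d]) (auto simp: coef_filter_deg)
  moreover have "cnorm A (evp ?q) \<le> real (length ds) * M"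
  proof (rule Cons.IH)
    fix y x
    have "coef ?q y x = coef p y x \<or> coef ?q y x = 0"
      using app[of y x] by (auto simp: coef_filter_deg split: if_splits)
    then show "cmod (coef ?q y x) \<le> M"
      using Cons.prems(2) Cons.prems(3)[of y x] by auto
  qed (use Cons.prems in auto)
  ultimately show ?case
    using evp_filter[of p "\<lambda>(a, w). deg w = d"] norm_triangle[of "evp ?p" "evp ?q"]
    by (simp add: distrib_right algebra_simps)
qed

text \<open>The factor counts the possible degrees of words of length at most \<open>L\<close>, from
  \<open>- L\<close> to \<open>L\<close>; each homogeneous part has norm at most
  \<open>M\<close>.\<close>

lemma norm_le_coef:
  assumes "plength p L" "0 \<le> M" "\<And>y x. cmod (coef p y x) \<le> M"
  shows "cnorm A (evp p) \<le> (2 * real L + 1) * M"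
proof -
  have "deg w \<in> set [- int L..int L]" if "(a, w) \<in> set p" for a w
    using abs_deg_le[of w] assms(1) that by (force simp: plength_def)
  from norm_degrees[OF this assms(2,3)] show ?thesis
    by (simp add: add_ac)
qed

end

lemma norm_evp_le:
  assumes "bicovariant_representation A S" "bicovariant_representation B W"
    and "\<And>xs. bicovariant_representation.s S xs \<noteq> \<zero>\<^bsub>A\<^esub>"
  shows "cnorm B (bicovariant_representation.evp B W p)
    \<le> cnorm A (bicovariant_representation.evp A S p)"
proof -
  interpret A: bicovariant_representation A S by fact
  interpret B: bicovariant_representation B W by fact
  obtain L where L: "plength p L" using plength_ex by blast
  show ?thesis
  proof (rule power_iterate_le)
    fix k :: nat
    have "cnorm B (B.evp p) ^ 2 ^ k = cnorm B (B.evp (psq_iter p k))"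
      by (simp add: B.evp_psq_iter B.norm_sq_iter)
    also have "\<dots> \<le> (2 * real (L * 2 ^ k) + 1) * cnorm A (A.evp (psq_iter p k))"
      using B.norm_le_coef[OF plength_psq_iter[OF L], of "cnorm A (A.evp (psq_iter p k))" k]
        A.coef_le_norm[OF assms(3)] by simp
    also have "\<dots> \<le> ((2 * real L + 1) * 2 ^ k) * cnorm A (A.evp (psq_iter p k))"
      by (intro mult_right_mono) (auto simp: algebra_simps)
    also have "\<dots> = (2 * real L + 1) * 2 ^ k * cnorm A (A.evp p) ^ 2 ^ k"
      by (simp add: A.evp_psq_iter A.norm_sq_iter)
    finally show "cnorm B (B.evp p) ^ 2 ^ k \<le> (2 * real L + 1) * 2 ^ k * cnorm A (A.evp p) ^ 2 ^ k" .
  qed auto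
qed

section \<open>Extension to the generated C*-algebra\<close>

lemma tendsto_zero_le:
  fixes f g :: "nat \<Rightarrow> real"
  assumes "g \<longlonglongrightarrow> 0" "\<And>n. 0 \<le> f n" "\<And>n. f n \<le> g n"
  shows "f \<longlonglongrightarrow> 0"
  using assms by (intro tendsto_sandwich[of "\<lambda>_. 0" f sequentially g 0]) auto

context cstar_algebra
begin

lemma tendsto_imp_Cauchy:
  assumes "\<And>n. X n \<in> carrier A" "x \<in> carrier A" "cstar_tendsto A X x"
  shows "cstar_Cauchy A X"
  unfolding cstar_Cauchy_def
proof (intro allI impI)
  fix e :: real assume "0 < e"
  then have "\<forall>\<^sub>F n in sequentially. cnorm A (X n \<ominus> x) < e / 2"
    using assms(3) unfolding cstar_tendsto_def by (intro order_tendstoD) auto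
  then obtain N where N: "\<And>n. n \<ge> N \<Longrightarrow> cnorm A (X n \<ominus> x) < e / 2"
    by (auto simp: eventually_sequentially)
  show "\<exists>N. \<forall>m\<ge>N. \<forall>n\<ge>N. cnorm A (X m \<ominus> X n) < e"
  proof (intro exI allI impI)
    fix m n assume "N \<le> m" "N \<le> n"
    then show "cnorm A (X m \<ominus> X n) < e"
      using N[of m] N[of n] norm_minus_triangle[of "X m" x "X n"] norm_minus_commute[of x "X n"]
        assms by force
  qed
qed

lemma norm_mult_diff:
  assumes "x \<in> carrier A" "y \<in> carrier A" "x' \<in> carrier A" "y' \<in> carrier A"
  shows "cnorm A (x \<otimes> y \<ominus> x' \<otimes> y')
    \<le> cnorm A (x \<ominus> x') * cnorm A y + cnorm A x' * cnorm A (y \<ominus> y')"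
proof -
  have "cnorm A (x \<otimes> y \<ominus> x' \<otimes> y')
      \<le> cnorm A ((x \<ominus> x') \<otimes> y) + cnorm A (x' \<otimes> (y \<ominus> y'))"
    using norm_minus_triangle[of "x \<otimes> y" "x' \<otimes> y" "x' \<otimes> y'"] assms
    by (simp add: l_distrib_minus r_distrib_minus)
  also have "\<dots> \<le> cnorm A (x \<ominus> x') * cnorm A y + cnorm A x' * cnorm A (y \<ominus> y')"
    using assms by (intro add_mono norm_mult) auto
  finally show ?thesis .
qed

lemma tendsto_add:
  assumes X: "\<And>n. X n \<in> carrier A" "x \<in> carrier A" "cstar_tendsto A X x"
    and Y: "\<And>n. Y n \<in> carrier A" "y \<in> carrier A" "cstar_tendsto A Y y"
  shows "cstar_tendsto A (\<lambda>n. X n \<oplus> Y n) (x \<oplus> y)"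
  unfolding cstar_tendsto_def
proof (rule tendsto_zero_le)
  show "(\<lambda>n. cnorm A (X n \<ominus> x) + cnorm A (Y n \<ominus> y)) \<longlonglongrightarrow> 0"
    using Limits.tendsto_add[OF X(3)[unfolded cstar_tendsto_def] Y(3)[unfolded cstar_tendsto_def]]
    by simp
qed (use X Y in \<open>auto simp: add_diff_add intro!: norm_triangle\<close>)

lemma tendsto_mult:
  assumes X: "\<And>n. X n \<in> carrier A" "x \<in> carrier A" "cstar_tendsto A X x"
    and Y: "\<And>n. Y n \<in> carrier A" "y \<in> carrier A" "cstar_tendsto A Y y"
  shows "cstar_tendsto A (\<lambda>n. X n \<otimes> Y n) (x \<otimes> y)"
  unfolding cstar_tendsto_def
proof (rule tendsto_zero_le)
  let ?f = "\<lambda>n. cnorm A (X n \<ominus> x)" and ?g = "\<lambda>n. cnorm A (Y n \<ominus> y)"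
  have "(\<lambda>n. ?f n * (cnorm A y + ?g n) + cnorm A x * ?g n) \<longlonglongrightarrow> 0 * (cnorm A y + 0) + cnorm A x * 0"
    using X(3) Y(3) unfolding cstar_tendsto_def by (intro tendsto_intros)
  then show "(\<lambda>n. ?f n * (cnorm A y + ?g n) + cnorm A x * ?g n) \<longlonglongrightarrow> 0" by simp
  show "cnorm A (X n \<otimes> Y n \<ominus> x \<otimes> y) \<le> ?f n * (cnorm A y + ?g n) + cnorm A x * ?g n" for n
    using norm_mult_diff[of "X n" "Y n" x y] X Y
      mult_left_mono[OF norm_triangle_minus[of "Y n" y], of "?f n"] by fastforce
qed (use X Y in auto)

lemma tendsto_scale:
  assumes X: "\<And>n. X n \<in> carrier A" "x \<in> carrier A" "cstar_tendsto A X x"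
  shows "cstar_tendsto A (\<lambda>n. scale A c (X n)) (scale A c x)"
proof -
  have "cnorm A (scale A c (X n) \<ominus> scale A c x) = cmod c * cnorm A (X n \<ominus> x)" for n
    using X norm_scale[of "X n \<ominus> x" c] by (simp add: minus_eq_scale scale_add_right scale_scale mult.commute)
  then show ?thesis
    using tendsto_mult_right_zero[OF X(3)[unfolded cstar_tendsto_def], of "cmod c"]
    by (simp add: cstar_tendsto_def)
qed

lemma tendsto_star:
  assumes X: "\<And>n. X n \<in> carrier A" "x \<in> carrier A" "cstar_tendsto A X x"
  shows "cstar_tendsto A (\<lambda>n. star A (X n)) (star A x)"
proof -
  have "cnorm A (star A (X n) \<ominus> star A x) = cnorm A (X n \<ominus> x)" for n
    using X norm_star[of "X n \<ominus> x"] by (simp add: star_minus)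
  then show ?thesis using X(3) by (simp add: cstar_tendsto_def)
qed

lemma tendsto_unique:
  assumes "\<And>n. X n \<in> carrier A" "x \<in> carrier A" "y \<in> carrier A"
    and "cstar_tendsto A X x" "cstar_tendsto A X y"
  shows "x = y"
proof -
  have "(\<lambda>n. cnorm A (X n \<ominus> x) + cnorm A (X n \<ominus> y)) \<longlonglongrightarrow> 0 + 0"
    using assms(4,5) unfolding cstar_tendsto_def by (intro tendsto_intros)
  moreover have "cnorm A (x \<ominus> y) \<le> cnorm A (X n \<ominus> x) + cnorm A (X n \<ominus> y)" for n
    using norm_minus_triangle[of x "X n" y] norm_minus_commute[of x "X n"] assms by simp
  ultimately have "cnorm A (x \<ominus> y) \<le> 0"
    using LIMSEQ_le_const[of _ "0 + 0" "cnorm A (x \<ominus> y)"] by auto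
  then show ?thesis
    using assms norm_nonneg[of "x \<ominus> y"] norm_eq_0_iff[of "x \<ominus> y"] minus_eq_zero_iff
    by (metis minus_closed order_antisym)
qed

end

section \<open>The closed graph of the map from p(S) to p(W)\<close>

locale two_bicovariant_representations =
  A: bicovariant_representation A S + B: bicovariant_representation B W
  for A :: "('a, 'm) cstar_scheme" and S and B :: "('b, 'n) cstar_scheme" and W +
  assumes nonzero: "\<And>xs. A.s xs \<noteq> \<zero>\<^bsub>A\<^esub>"
begin

lemma norm_diff_le: "cnorm B (B.evp p \<ominus>\<^bsub>B\<^esub> B.evp q) \<le> cnorm A (A.evp p \<ominus>\<^bsub>A\<^esub> A.evp q)"
  using norm_evp_le[OF A.bicovariant_representation_axioms B.bicovariant_representation_axioms nonzero,
      of "p @ pscale (- 1) q"]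
  by (simp add: A.evp_append B.evp_append A.evp_pscale B.evp_pscale A.minus_eq_scale B.minus_eq_scale)

text \<open>The closure of the set of pairs (p(S), p(W)): one sequence of polynomials approximates
  both components. As a relation it can be shown to respect the operations before it is known to be
  a function.\<close>

definition graph :: "'a \<Rightarrow> 'b \<Rightarrow> bool" where
  "graph x y \<longleftrightarrow> x \<in> carrier A \<and> y \<in> carrier B \<and>
     (\<exists>p. cstar_tendsto A (\<lambda>n. A.evp (p n)) x \<and> cstar_tendsto B (\<lambda>n. B.evp (p n)) y)"

lemma graph_limit_ex:
  assumes "x \<in> carrier A" "cstar_tendsto A (\<lambda>n. A.evp (p n)) x"
  shows "\<exists>y. graph x y"
proof -
  have "cstar_Cauchy A (\<lambda>n. A.evp (p n))"
    using assms by (intro A.tendsto_imp_Cauchy) auto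
  then have "cstar_Cauchy B (\<lambda>n. B.evp (p n))"
    unfolding cstar_Cauchy_def by (meson norm_diff_le order_le_less_trans)
  then show ?thesis
    using B.complete[of "\<lambda>n. B.evp (p n)"] assms unfolding graph_def by auto
qed

text \<open>Two polynomial sequences with the same limit in \<open>A\<close> approach each other
  there, hence also in \<open>B\<close> by \<open>norm_diff_le\<close>.\<close>

lemma graph_unique:
  assumes "graph x y" "graph x y'"
  shows "y = y'"
proof -
  obtain p q where x: "x \<in> carrier A" and y: "y \<in> carrier B" "y' \<in> carrier B"
    and p: "cstar_tendsto A (\<lambda>n. A.evp (p n)) x" "cstar_tendsto B (\<lambda>n. B.evp (p n)) y"
    and q: "cstar_tendsto A (\<lambda>n. A.evp (q n)) x" "cstar_tendsto B (\<lambda>n. B.evp (q n)) y'"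
    using assms by (auto simp: graph_def)
  have "(\<lambda>n. cnorm A (A.evp (p n) \<ominus>\<^bsub>A\<^esub> x) + cnorm A (A.evp (q n) \<ominus>\<^bsub>A\<^esub> x)
      + cnorm B (B.evp (q n) \<ominus>\<^bsub>B\<^esub> y')) \<longlonglongrightarrow> 0 + 0 + 0"
    using p(1) q unfolding cstar_tendsto_def by (intro tendsto_intros)
  moreover have "cnorm B (B.evp (p n) \<ominus>\<^bsub>B\<^esub> y') \<le> cnorm A (A.evp (p n) \<ominus>\<^bsub>A\<^esub> x)
      + cnorm A (A.evp (q n) \<ominus>\<^bsub>A\<^esub> x) + cnorm B (B.evp (q n) \<ominus>\<^bsub>B\<^esub> y')" for n
    using B.norm_minus_triangle[of "B.evp (p n)" "B.evp (q n)" y'] norm_diff_le[of "p n" "q n"]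
      A.norm_minus_triangle[of "A.evp (p n)" x "A.evp (q n)"] A.norm_minus_commute[of x "A.evp (q n)"]
      x y by simp
  ultimately have "cstar_tendsto B (\<lambda>n. B.evp (p n)) y'"
    unfolding cstar_tendsto_def
    by (intro tendsto_zero_le[of _ "\<lambda>n. cnorm B (B.evp (p n) \<ominus>\<^bsub>B\<^esub> y')"]) (use y in auto)
  then show ?thesis
    using B.tendsto_unique p(2) y by (metis B.evp_closed)
qed

lemma graph_add: "graph x y \<Longrightarrow> graph x' y' \<Longrightarrow> graph (x \<oplus>\<^bsub>A\<^esub> x') (y \<oplus>\<^bsub>B\<^esub> y')"
proof -
  assume "graph x y" "graph x' y'"
  then obtain p q where c: "x \<in> carrier A" "y \<in> carrier B" "x' \<in> carrier A" "y' \<in> carrier B"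
    and p: "cstar_tendsto A (\<lambda>n. A.evp (p n)) x" "cstar_tendsto B (\<lambda>n. B.evp (p n)) y"
    and q: "cstar_tendsto A (\<lambda>n. A.evp (q n)) x'" "cstar_tendsto B (\<lambda>n. B.evp (q n)) y'"
    by (auto simp: graph_def)
  have "cstar_tendsto A (\<lambda>n. A.evp (p n @ q n)) (x \<oplus>\<^bsub>A\<^esub> x')"
    "cstar_tendsto B (\<lambda>n. B.evp (p n @ q n)) (y \<oplus>\<^bsub>B\<^esub> y')"
    using c p q by (auto simp: A.evp_append B.evp_append intro!: A.tendsto_add B.tendsto_add)
  then show ?thesis using c unfolding graph_def by auto
qed

lemma graph_mult: "graph x y \<Longrightarrow> graph x' y' \<Longrightarrow> graph (x \<otimes>\<^bsub>A\<^esub> x') (y \<otimes>\<^bsub>B\<^esub> y')"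
proof -
  assume "graph x y" "graph x' y'"
  then obtain p q where c: "x \<in> carrier A" "y \<in> carrier B" "x' \<in> carrier A" "y' \<in> carrier B"
    and p: "cstar_tendsto A (\<lambda>n. A.evp (p n)) x" "cstar_tendsto B (\<lambda>n. B.evp (p n)) y"
    and q: "cstar_tendsto A (\<lambda>n. A.evp (q n)) x'" "cstar_tendsto B (\<lambda>n. B.evp (q n)) y'"
    by (auto simp: graph_def)
  have "cstar_tendsto A (\<lambda>n. A.evp (pmult (p n) (q n))) (x \<otimes>\<^bsub>A\<^esub> x')"
    "cstar_tendsto B (\<lambda>n. B.evp (pmult (p n) (q n))) (y \<otimes>\<^bsub>B\<^esub> y')"
    using c p q by (auto simp: A.evp_pmult B.evp_pmult intro!: A.tendsto_mult B.tendsto_mult)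
  then show ?thesis using c unfolding graph_def by auto
qed

lemma graph_scale: "graph x y \<Longrightarrow> graph (scale A c x) (scale B c y)"
proof -
  assume "graph x y"
  then obtain p where c: "x \<in> carrier A" "y \<in> carrier B"
    and p: "cstar_tendsto A (\<lambda>n. A.evp (p n)) x" "cstar_tendsto B (\<lambda>n. B.evp (p n)) y"
    by (auto simp: graph_def)
  have "cstar_tendsto A (\<lambda>n. A.evp (pscale c (p n))) (scale A c x)"
    "cstar_tendsto B (\<lambda>n. B.evp (pscale c (p n))) (scale B c y)"
    using c p by (auto simp: A.evp_pscale B.evp_pscale intro!: A.tendsto_scale B.tendsto_scale)
  then show ?thesis using c unfolding graph_def by auto
qed

lemma graph_star: "graph x y \<Longrightarrow> graph (star A x) (star B y)"
proof -
  assume "graph x y"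
  then obtain p where c: "x \<in> carrier A" "y \<in> carrier B"
    and p: "cstar_tendsto A (\<lambda>n. A.evp (p n)) x" "cstar_tendsto B (\<lambda>n. B.evp (p n)) y"
    by (auto simp: graph_def)
  have "cstar_tendsto A (\<lambda>n. A.evp (pstar (p n))) (star A x)"
    "cstar_tendsto B (\<lambda>n. B.evp (pstar (p n))) (star B y)"
    using c p by (auto simp: A.evp_pstar B.evp_pstar intro!: A.tendsto_star B.tendsto_star)
  then show ?thesis using c unfolding graph_def by auto
qed

lemma graph_evp: "graph (A.evp p) (B.evp p)"
  unfolding graph_def cstar_tendsto_def by (auto intro!: exI[of _ "\<lambda>_. p"])

lemma graph_gen: "graph (A.s xs) (B.s xs)"
  using graph_evp[of "[(1, pos_word xs)]"] by (simp add: A.ev_pos_word B.ev_pos_word)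

lemma subalgebra_graph: "cstar_subalgebra A {x. \<exists>y. graph x y}"
  unfolding cstar_subalgebra_def
proof (intro conjI allI impI ballI)
  show "{x. \<exists>y. graph x y} \<subseteq> carrier A" by (auto simp: graph_def)
  show "\<zero>\<^bsub>A\<^esub> \<in> {x. \<exists>y. graph x y}" using graph_evp[of "[]"] by auto
  fix X x assume X: "\<forall>n. X n \<in> {x. \<exists>y. graph x y}" and x: "x \<in> carrier A" "cstar_tendsto A X x"
  have Xc: "X n \<in> carrier A" for n using X by (auto simp: graph_def)
  \<comment> \<open>A diagonal choice: the polynomials only need to approximate in \<open>A\<close>,
    since contractivity supplies the limit in \<open>B\<close>.\<close>
  have "\<exists>p. cnorm A (A.evp p \<ominus>\<^bsub>A\<^esub> X n) < 1 / (real n + 1)" for n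
  proof -
    obtain p where "cstar_tendsto A (\<lambda>k. A.evp (p k)) (X n)"
      using X by (auto simp: graph_def)
    then have "\<forall>\<^sub>F k in sequentially. cnorm A (A.evp (p k) \<ominus>\<^bsub>A\<^esub> X n) < 1 / (real n + 1)"
      unfolding cstar_tendsto_def by (intro order_tendstoD) auto
    then show ?thesis by (auto simp: eventually_sequentially)
  qed
  then obtain p where p: "\<And>n. cnorm A (A.evp (p n) \<ominus>\<^bsub>A\<^esub> X n) < 1 / (real n + 1)"
    by metis
  have "(\<lambda>n. 1 / (real n + 1) + cnorm A (X n \<ominus>\<^bsub>A\<^esub> x)) \<longlonglongrightarrow> 0 + 0"
    using x(2) LIMSEQ_inverse_real_of_nat unfolding cstar_tendsto_def
    by (intro Limits.tendsto_add) (auto simp: field_simps inverse_eq_divide)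
  moreover have "cnorm A (A.evp (p n) \<ominus>\<^bsub>A\<^esub> x) \<le> 1 / (real n + 1) + cnorm A (X n \<ominus>\<^bsub>A\<^esub> x)" for n
    using A.norm_minus_triangle[of "A.evp (p n)" "X n" x] p[of n] Xc x by simp
  ultimately have "cstar_tendsto A (\<lambda>n. A.evp (p n)) x"
    unfolding cstar_tendsto_def
    by (intro tendsto_zero_le[of _ "\<lambda>n. cnorm A (A.evp (p n) \<ominus>\<^bsub>A\<^esub> x)"]) (use x in auto)
  then show "x \<in> {x. \<exists>y. graph x y}"
    using graph_limit_ex[OF x(1)] by blast
qed (use graph_add graph_mult graph_scale graph_star in blast)+

text \<open>The domain of \<open>graph\<close> is a C*-subalgebra containing every
  \<open>S \<mu>\<close>, hence it contains the generated one, and there the unique partner defines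
  the homomorphism.\<close>

lemma hom_ex:
  "\<exists>\<phi>. cstar_hom A (cstar_generated A (S ` \<F>\<^sub>\<infinity>\<^sup>+)) B \<phi> \<and> (\<forall>\<mu>\<in>\<F>\<^sub>\<infinity>\<^sup>+. \<phi> (S \<mu>) = W \<mu>)"
proof -
  define \<phi> where "\<phi> x = (THE y. graph x y)" for x
  have \<phi>: "\<phi> x = y" if "graph x y" for x y
    unfolding \<phi>_def using that graph_unique by blast
  let ?D = "cstar_generated A (S ` \<F>\<^sub>\<infinity>\<^sup>+)"
  have gen: "graph (S \<mu>) (W \<mu>)" if "\<mu> \<in> \<F>\<^sub>\<infinity>\<^sup>+" for \<mu>
    using that graph_gen by (auto simp: free_semigroup_inf_eq A.s_def B.s_def)
  then have "?D \<subseteq> {x. \<exists>y. graph x y}"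
    using subalgebra_graph unfolding cstar_generated_def by blast
  then have D: "graph x (\<phi> x)" if "x \<in> ?D" for x
    using that \<phi> by auto
  have "cstar_hom A ?D B \<phi>"
    unfolding cstar_hom_def
  proof (intro conjI ballI allI)
    show "\<phi> x \<in> carrier B" if "x \<in> ?D" for x
      using D[OF that] by (simp add: graph_def)
  qed (intro \<phi> graph_add graph_mult graph_scale graph_star D; assumption)+
  then show ?thesis using gen \<phi> by blast
qed

end

section \<open>Matrix algebras\<close>

type_synonym matrix = "nat \<Rightarrow> nat \<Rightarrow> complex"

definition mapp :: "nat \<Rightarrow> matrix \<Rightarrow> (nat \<Rightarrow> complex) \<Rightarrow> nat \<Rightarrow> complex" where
  "mapp n M y i = (\<Sum>j\<le>n. M i j * y j)"

definition vnorm :: "nat \<Rightarrow> (nat \<Rightarrow> complex) \<Rightarrow> real" where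
  "vnorm n y = L2_set (\<lambda>i. cmod (y i)) {..n}"

definition mnorm :: "nat \<Rightarrow> matrix \<Rightarrow> real" where
  "mnorm n M = (SUP y\<in>{y. vnorm n y \<le> 1}. vnorm n (mapp n M y))"

text \<open>Square matrices of size n + 1, one index for each cut of a word of length n. Storing
  them as functions that vanish outside this range lets one type serve all sizes and makes equality
  extensional.\<close>

definition matrix_cstar :: "nat \<Rightarrow> matrix cstar" where
  "matrix_cstar n = \<lparr>carrier = {M. \<forall>i j. M i j \<noteq> 0 \<longrightarrow> i \<le> n \<and> j \<le> n},
     mult = (\<lambda>M N i j. \<Sum>k\<le>n. M i k * N k j), one = (\<lambda>i j. 0), zero = (\<lambda>i j. 0),
     add = (\<lambda>M N i j. M i j + N i j), scale = (\<lambda>c M i j. c * M i j),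
     star = (\<lambda>M i j. cnj (M j i)), cnorm = mnorm n\<rparr>"

lemma vnorm_nonneg [simp]: "0 \<le> vnorm n y"
  by (simp add: vnorm_def)

lemma vnorm_triangle: "vnorm n (\<lambda>i. x i + y i) \<le> vnorm n x + vnorm n y"
proof -
  have "vnorm n (\<lambda>i. x i + y i) \<le> L2_set (\<lambda>i. cmod (x i) + cmod (y i)) {..n}"
    unfolding vnorm_def by (intro L2_set_mono norm_triangle_ineq) auto
  also have "\<dots> \<le> vnorm n x + vnorm n y"
    unfolding vnorm_def by (rule L2_set_triangle_ineq)
  finally show ?thesis .
qed

lemma vnorm_scale: "vnorm n (\<lambda>i. c * y i) = cmod c * vnorm n y"
  unfolding vnorm_def by (simp add: norm_mult L2_set_right_distrib)

lemma norm_le_vnorm: "i \<le> n \<Longrightarrow> cmod (y i) \<le> vnorm n y"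
  unfolding vnorm_def by (rule member_le_L2_set) auto

lemma vnorm_mapp_le_sum: "vnorm n (mapp n M y) \<le> (\<Sum>i\<le>n. \<Sum>j\<le>n. cmod (M i j)) * vnorm n y"
proof -
  have "vnorm n (mapp n M y) \<le> (\<Sum>i\<le>n. cmod (mapp n M y i))"
    unfolding vnorm_def by (rule L2_set_le_sum) auto
  also have "\<dots> \<le> (\<Sum>i\<le>n. \<Sum>j\<le>n. cmod (M i j) * vnorm n y)"
    unfolding mapp_def
    by (intro sum_mono sum_norm_le) (auto simp: norm_mult intro!: mult_left_mono norm_le_vnorm)
  finally show ?thesis by (simp add: sum_distrib_right)
qed

lemma mnorm_bdd: "bdd_above ((\<lambda>y. vnorm n (mapp n M y)) ` {y. vnorm n y \<le> 1})"
proof (rule bdd_aboveI2)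
  fix y assume "y \<in> {y. vnorm n y \<le> 1}"
  then have "(\<Sum>i\<le>n. \<Sum>j\<le>n. cmod (M i j)) * vnorm n y \<le> (\<Sum>i\<le>n. \<Sum>j\<le>n. cmod (M i j)) * 1"
    by (intro mult_left_mono sum_nonneg) auto
  then show "vnorm n (mapp n M y) \<le> (\<Sum>i\<le>n. \<Sum>j\<le>n. cmod (M i j))"
    using vnorm_mapp_le_sum[of n M y] by simp
qed

lemma mapp_scale: "mapp n M (\<lambda>i. c * y i) = (\<lambda>i. c * mapp n M y i)"
  by (auto simp: mapp_def sum_distrib_left mult_ac)

lemma vnorm_mapp_le: "vnorm n (mapp n M y) \<le> mnorm n M * vnorm n y"
proof (cases "vnorm n y = 0")
  case True
  then show ?thesis using vnorm_mapp_le_sum[of n M y] by simp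
next
  case False
  then have pos: "0 < vnorm n y" by (simp add: order_less_le)
  let ?c = "complex_of_real (1 / vnorm n y)"
  have "vnorm n (\<lambda>i. ?c * y i) = 1"
    using pos unfolding vnorm_scale by (simp add: norm_divide)
  then have "vnorm n (mapp n M (\<lambda>i. ?c * y i)) \<le> mnorm n M"
    unfolding mnorm_def by (intro cSUP_upper mnorm_bdd) auto
  then have "vnorm n (mapp n M y) / vnorm n y \<le> mnorm n M"
    using pos unfolding mapp_scale vnorm_scale by (simp add: norm_divide)
  then show ?thesis using pos by (simp add: field_simps)
qed

lemma mnorm_le:
  assumes "0 \<le> c" "\<And>y. vnorm n (mapp n M y) \<le> c * vnorm n y"
  shows "mnorm n M \<le> c"
  unfolding mnorm_def
proof (rule cSUP_least)
  have "vnorm n (\<lambda>i. 0) \<le> 1" by (simp add: vnorm_def L2_set_0')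
  then show "{y. vnorm n y \<le> 1} \<noteq> {}" by blast
next
  fix y assume "y \<in> {y. vnorm n y \<le> 1}"
  then show "vnorm n (mapp n M y) \<le> c"
    using assms(2)[of y] mult_left_mono[of "vnorm n y" 1 c] assms(1) by simp
qed

lemma mnorm_le_sum: "mnorm n M \<le> (\<Sum>i\<le>n. \<Sum>j\<le>n. cmod (M i j))"
  by (rule mnorm_le) (auto intro!: vnorm_mapp_le_sum sum_nonneg)

lemma norm_entry_le: assumes "i \<le> n" "j \<le> n" shows "cmod (M i j) \<le> mnorm n M"
proof -
  let ?e = "\<lambda>k. if k = j then 1 else 0 :: complex"
  have "vnorm n ?e = 1"
    using assms(2) by (simp add: vnorm_def L2_set_def if_distrib[of cmod] if_distrib[of "\<lambda>x. x\<^sup>2"] cong: if_cong)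
  moreover have "mapp n M ?e i = M i j"
    using assms(2) by (simp add: mapp_def if_distrib[of "\<lambda>x. _ * x"] cong: if_cong)
  ultimately show ?thesis
    using norm_le_vnorm[OF assms(1), of "mapp n M ?e"] vnorm_mapp_le[of n M ?e] by simp
qed

lemma mnorm_nonneg [simp]: "0 \<le> mnorm n M"
  using norm_entry_le[of 0 n 0 M] norm_ge_zero[of "M 0 0"] by linarith

lemma mapp_mult: "mapp n (\<lambda>i j. \<Sum>k\<le>n. M i k * N k j) y = mapp n M (mapp n N y)"
proof
  fix i
  have "mapp n (\<lambda>i j. \<Sum>k\<le>n. M i k * N k j) y i = (\<Sum>j\<le>n. \<Sum>k\<le>n. M i k * (N k j * y j))"
    by (simp add: mapp_def sum_distrib_right mult.assoc)
  also have "\<dots> = (\<Sum>k\<le>n. \<Sum>j\<le>n. M i k * (N k j * y j))"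
    by (rule sum.swap)
  finally show "mapp n (\<lambda>i j. \<Sum>k\<le>n. M i k * N k j) y i = mapp n M (mapp n N y) i"
    by (simp add: mapp_def sum_distrib_left)
qed

lemma mnorm_mult: "mnorm n (\<lambda>i j. \<Sum>k\<le>n. M i k * N k j) \<le> mnorm n M * mnorm n N"
proof (rule mnorm_le)
  fix y
  have "vnorm n (mapp n M (mapp n N y)) \<le> mnorm n M * vnorm n (mapp n N y)"
    by (rule vnorm_mapp_le)
  also have "\<dots> \<le> mnorm n M * (mnorm n N * vnorm n y)"
    by (intro mult_left_mono vnorm_mapp_le) simp
  finally show "vnorm n (mapp n (\<lambda>i j. \<Sum>k\<le>n. M i k * N k j) y) \<le> mnorm n M * mnorm n N * vnorm n y"
    unfolding mapp_mult by (simp add: mult.assoc)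
qed simp

lemma mnorm_triangle: "mnorm n (\<lambda>i j. M i j + N i j) \<le> mnorm n M + mnorm n N"
proof (rule mnorm_le)
  fix y
  have "mapp n (\<lambda>i j. M i j + N i j) y = (\<lambda>i. mapp n M y i + mapp n N y i)"
    by (auto simp: mapp_def distrib_right sum.distrib)
  then have "vnorm n (mapp n (\<lambda>i j. M i j + N i j) y) \<le> vnorm n (mapp n M y) + vnorm n (mapp n N y)"
    using vnorm_triangle by simp
  also have "\<dots> \<le> mnorm n M * vnorm n y + mnorm n N * vnorm n y"
    by (intro add_mono vnorm_mapp_le)
  finally show "vnorm n (mapp n (\<lambda>i j. M i j + N i j) y) \<le> (mnorm n M + mnorm n N) * vnorm n y"
    by (simp add: distrib_right)
qed simp

lemma mnorm_scale: "mnorm n (\<lambda>i j. c * M i j) = cmod c * mnorm n M"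
proof -
  have le: "mnorm n (\<lambda>i j. c * M i j) \<le> cmod c * mnorm n M" for c M
  proof (rule mnorm_le)
    fix y
    have "mapp n (\<lambda>i j. c * M i j) y = (\<lambda>i. c * mapp n M y i)"
      by (auto simp: mapp_def sum_distrib_left mult.assoc)
    then show "vnorm n (mapp n (\<lambda>i j. c * M i j) y) \<le> cmod c * mnorm n M * vnorm n y"
      using mult_left_mono[OF vnorm_mapp_le[of n M y], of "cmod c"] by (simp add: vnorm_scale mult.assoc)
  qed simp
  show ?thesis
  proof (cases "c = 0")
    case True
    then show ?thesis using le[of 0 M] mnorm_nonneg[of n "\<lambda>i j. 0"] by simp
  next
    case False
    then have "mnorm n M \<le> cmod (inverse c) * mnorm n (\<lambda>i j. c * M i j)"
      using le[of "inverse c" "\<lambda>i j. c * M i j"] by (simp flip: mult.assoc)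
    then have "cmod c * mnorm n M \<le> mnorm n (\<lambda>i j. c * M i j)"
      using False unfolding norm_inverse by (simp add: field_simps)
    then show ?thesis using le[of c M] by simp
  qed
qed

text \<open>The squared norm of M y is the inner product of y with M* M y, so Cauchy-Schwarz gives
  one inequality. That inequality implies that the star is isometric, which gives the other.\<close>

lemma mnorm_star_mult:
  "mnorm n (\<lambda>i j. \<Sum>k\<le>n. cnj (M k i) * M k j) = (mnorm n M)\<^sup>2"
proof -
  let ?s = "\<lambda>M i j. cnj (M j i) :: complex"
  let ?Q = "\<lambda>M i j. \<Sum>k\<le>n. cnj (M k i) * M k j"
  have sq: "(mnorm n M)\<^sup>2 \<le> mnorm n (?Q M)" for M
  proof -
    have "vnorm n (mapp n M y) \<le> sqrt (mnorm n (?Q M)) * vnorm n y" for y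
    proof -
      let ?x = "mapp n M y"
      have "complex_of_real ((vnorm n ?x)\<^sup>2) = (\<Sum>i\<le>n. cnj (?x i) * ?x i)"
        by (simp add: vnorm_def L2_set_def sum_nonneg complex_norm_square mult.commute del: of_real_power)
      also have "\<dots> = (\<Sum>i\<le>n. \<Sum>j\<le>n. cnj (y j) * (cnj (M i j) * ?x i))"
      proof (intro sum.cong refl)
        fix i
        have "cnj (?x i) = (\<Sum>j\<le>n. cnj (y j) * cnj (M i j))"
          by (simp add: mapp_def mult.commute)
        then show "cnj (?x i) * ?x i = (\<Sum>j\<le>n. cnj (y j) * (cnj (M i j) * ?x i))"
          by (simp add: sum_distrib_right mult.assoc)
      qed
      also have "\<dots> = (\<Sum>j\<le>n. \<Sum>i\<le>n. cnj (y j) * (cnj (M i j) * ?x i))"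
        by (rule sum.swap)
      also have "\<dots> = (\<Sum>j\<le>n. cnj (y j) * mapp n (?s M) ?x j)"
        by (simp add: mapp_def[of n "?s M"] sum_distrib_left)
      also have "mapp n (?s M) ?x = mapp n (?Q M) y"
        by (simp flip: mapp_mult)
      finally have "complex_of_real ((vnorm n ?x)\<^sup>2) = (\<Sum>j\<le>n. cnj (y j) * mapp n (?Q M) y j)" .
      then have "(vnorm n ?x)\<^sup>2 = cmod (\<Sum>j\<le>n. cnj (y j) * mapp n (?Q M) y j)"
        by (metis abs_of_nonneg norm_of_real zero_le_power2)
      also have "\<dots> \<le> (\<Sum>j\<le>n. \<bar>cmod (y j)\<bar> * \<bar>cmod (mapp n (?Q M) y j)\<bar>)"
        by (rule sum_norm_le) (simp add: norm_mult)
      also have "\<dots> \<le> vnorm n y * vnorm n (mapp n (?Q M) y)"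
        unfolding vnorm_def by (rule L2_set_mult_ineq)
      also have "\<dots> \<le> vnorm n y * (mnorm n (?Q M) * vnorm n y)"
        by (intro mult_left_mono vnorm_mapp_le) simp
      also have "\<dots> = (sqrt (mnorm n (?Q M)) * vnorm n y)\<^sup>2"
        by (simp add: power_mult_distrib power2_eq_square mult_ac)
      finally show ?thesis by (rule power2_le_imp_le) simp
    qed
    then have "mnorm n M \<le> sqrt (mnorm n (?Q M))"
      by (rule mnorm_le[rotated]) simp
    then have "(mnorm n M)\<^sup>2 \<le> (sqrt (mnorm n (?Q M)))\<^sup>2"
      by (rule power_mono) simp
    then show ?thesis by simp
  qed
  have star: "mnorm n M \<le> mnorm n (?s M)" for M
  proof (cases "mnorm n M = 0")
    case False
    have "mnorm n M * mnorm n M \<le> mnorm n (?s M) * mnorm n M"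
      using sq[of M] mnorm_mult[of n "?s M" M] by (simp add: power2_eq_square)
    moreover have "0 < mnorm n M" using False by (simp add: order_less_le)
    ultimately show ?thesis by simp
  qed simp
  have "mnorm n (?s M) = mnorm n M"
    using star[of M] star[of "?s M"] by simp
  then have "mnorm n (?Q M) \<le> (mnorm n M)\<^sup>2"
    using mnorm_mult[of n "?s M" M] by (simp add: power2_eq_square)
  then show ?thesis using sq[of M] by simp
qed

lemma abelian_group_matrix: "abelian_group (matrix_cstar n)"
proof (rule abelian_groupI)
  fix M assume M: "M \<in> carrier (matrix_cstar n)"
  then show "\<exists>N\<in>carrier (matrix_cstar n). N \<oplus>\<^bsub>matrix_cstar n\<^esub> M = \<zero>\<^bsub>matrix_cstar n\<^esub>"
    by (intro bexI[of _ "\<lambda>i j. - M i j"]) (auto simp: matrix_cstar_def)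
next
  fix M N assume "M \<in> carrier (matrix_cstar n)" "N \<in> carrier (matrix_cstar n)"
  then show "M \<oplus>\<^bsub>matrix_cstar n\<^esub> N \<in> carrier (matrix_cstar n)"
    by (auto simp: matrix_cstar_def) (metis add_0)+
qed (auto simp: matrix_cstar_def add_ac)

lemma minus_matrix:
  assumes "M \<in> carrier (matrix_cstar n)" "N \<in> carrier (matrix_cstar n)"
  shows "M \<ominus>\<^bsub>matrix_cstar n\<^esub> N = (\<lambda>i j. M i j - N i j)"
proof -
  interpret abelian_group "matrix_cstar n" by (rule abelian_group_matrix)
  have "\<ominus>\<^bsub>matrix_cstar n\<^esub> N = (\<lambda>i j. - N i j)"
    using assms(2) by (intro minus_equality) (auto simp: matrix_cstar_def)
  then show ?thesis by (auto simp: a_minus_def) (simp add: matrix_cstar_def)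
qed

lemma cstar_algebra_matrix: "cstar_algebra (matrix_cstar n)"
proof (intro cstar_algebra.intro abelian_group_matrix cstar_algebra_axioms.intro)
  let ?A = "matrix_cstar n"
  fix X assume X: "\<And>k. X k \<in> carrier ?A" and Cauchy: "cstar_Cauchy ?A X"
  have diff: "cnorm ?A (X k \<ominus>\<^bsub>?A\<^esub> X l) = mnorm n (\<lambda>i j. X k i j - X l i j)" for k l
    by (simp only: minus_matrix[OF X X]) (simp add: matrix_cstar_def)
  have zero: "X k i j = 0" if "\<not> (i \<le> n \<and> j \<le> n)" for k i j
    using X[of k] that by (auto simp: matrix_cstar_def)
  \<comment> \<open>Each entry is bounded by the norm, so limits exist entrywise; the norm is
    bounded by the sum of the entries, so these limits are limits in norm.\<close>
  have "convergent (\<lambda>k. X k i j)" for i j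
  proof (cases "i \<le> n \<and> j \<le> n")
    case True
    have "Cauchy (\<lambda>k. X k i j)"
    proof (rule metric_CauchyI)
      fix e :: real assume "0 < e"
      then obtain N where N: "\<And>k l. k \<ge> N \<Longrightarrow> l \<ge> N \<Longrightarrow> mnorm n (\<lambda>i j. X k i j - X l i j) < e"
        using Cauchy unfolding cstar_Cauchy_def diff by blast
      show "\<exists>N. \<forall>k\<ge>N. \<forall>l\<ge>N. dist (X k i j) (X l i j) < e"
      proof (intro exI allI impI)
        fix k l assume "N \<le> k" "N \<le> l"
        then show "dist (X k i j) (X l i j) < e"
          using N[of k l] norm_entry_le[of i n j "\<lambda>i j. X k i j - X l i j"] True
          by (simp add: dist_norm)
      qed
    qed
    then show ?thesis by (rule Cauchy_convergent)
  next
    case False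
    then show ?thesis by (simp add: zero convergent_const)
  qed
  then obtain L where L: "\<And>i j. (\<lambda>k. X k i j) \<longlonglongrightarrow> L i j"
    unfolding convergent_def by metis
  have "L i j = 0" if "\<not> (i \<le> n \<and> j \<le> n)" for i j
    using L[of i j] by (simp add: zero[OF that] LIMSEQ_const_iff)
  then have Lc: "L \<in> carrier ?A" by (auto simp: matrix_cstar_def)
  have "(\<lambda>k. \<Sum>i\<le>n. \<Sum>j\<le>n. cmod (X k i j - L i j)) \<longlonglongrightarrow> (\<Sum>i\<le>n. \<Sum>j\<le>n. cmod (L i j - L i j))"
    by (intro tendsto_intros L)
  then have "(\<lambda>k. \<Sum>i\<le>n. \<Sum>j\<le>n. cmod (X k i j - L i j)) \<longlonglongrightarrow> 0"
    by simp
  then have "(\<lambda>k. mnorm n (\<lambda>i j. X k i j - L i j)) \<longlonglongrightarrow> 0"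
    by (rule tendsto_zero_le) (auto intro: mnorm_le_sum)
  then have "cstar_tendsto ?A X L"
    unfolding cstar_tendsto_def minus_matrix[OF X Lc] by (simp add: matrix_cstar_def)
  then show "\<exists>x\<in>carrier ?A. cstar_tendsto ?A X x" using Lc by blast
next
  fix M N L :: matrix
  let ?A = "matrix_cstar n"
  show "M \<otimes>\<^bsub>?A\<^esub> N \<otimes>\<^bsub>?A\<^esub> L = M \<otimes>\<^bsub>?A\<^esub> (N \<otimes>\<^bsub>?A\<^esub> L)"
  proof (intro ext)
    fix i j
    have "(\<Sum>k\<le>n. (\<Sum>l\<le>n. M i l * N l k) * L k j) = (\<Sum>k\<le>n. \<Sum>l\<le>n. M i l * (N l k * L k j))"
      by (simp add: sum_distrib_right mult.assoc)
    also have "\<dots> = (\<Sum>l\<le>n. \<Sum>k\<le>n. M i l * (N l k * L k j))"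
      by (rule sum.swap)
    finally show "(M \<otimes>\<^bsub>?A\<^esub> N \<otimes>\<^bsub>?A\<^esub> L) i j = (M \<otimes>\<^bsub>?A\<^esub> (N \<otimes>\<^bsub>?A\<^esub> L)) i j"
      by (simp add: matrix_cstar_def sum_distrib_left)
  qed
next
  fix M N assume "M \<in> carrier (matrix_cstar n)" "N \<in> carrier (matrix_cstar n)"
  then show "M \<otimes>\<^bsub>matrix_cstar n\<^esub> N \<in> carrier (matrix_cstar n)"
    by (auto simp: matrix_cstar_def) (metis (no_types, lifting) mult_eq_0_iff sum.neutral)+
next
  fix M assume M: "M \<in> carrier (matrix_cstar n)"
  show "cnorm (matrix_cstar n) M = 0 \<longleftrightarrow> M = \<zero>\<^bsub>matrix_cstar n\<^esub>"
  proof
    assume "cnorm (matrix_cstar n) M = 0"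
    then have "mnorm n M = 0" by (simp add: matrix_cstar_def)
    then have "M i j = 0" if "i \<le> n" "j \<le> n" for i j
      using norm_entry_le[OF that, of M] by simp
    moreover have "i \<le> n \<and> j \<le> n" if "M i j \<noteq> 0" for i j
      using M that by (simp add: matrix_cstar_def)
    ultimately have "M i j = 0" for i j by blast
    then show "M = \<zero>\<^bsub>matrix_cstar n\<^esub>"
      by (simp add: matrix_cstar_def fun_eq_iff)
  next
    assume "M = \<zero>\<^bsub>matrix_cstar n\<^esub>"
    then show "cnorm (matrix_cstar n) M = 0"
      using mnorm_scale[of n 0 "\<lambda>i j. 0"] by (simp add: matrix_cstar_def)
  qed
next
  fix M
  show "cnorm (matrix_cstar n) (star (matrix_cstar n) M \<otimes>\<^bsub>matrix_cstar n\<^esub> M) =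
      (cnorm (matrix_cstar n) M)\<^sup>2"
    by (simp add: matrix_cstar_def mnorm_star_mult)
qed (auto simp: matrix_cstar_def mnorm_scale mnorm_triangle mnorm_mult
    sum.distrib distrib_left distrib_right sum_distrib_left mult_ac)

section \<open>Transport of a C*-algebra along an injection\<close>

text \<open>\<open>universal_rep\<close> tests only algebras with elements of type
  \<open>'b\<close>, so a matrix algebra must be copied into that type before it can serve as a
  target.\<close>

definition transport :: "('a, 'm) cstar_scheme \<Rightarrow> ('a \<Rightarrow> 'b) \<Rightarrow> 'b cstar" where
  "transport A f = (let g = inv_into (carrier A) f in
     \<lparr>carrier = f ` carrier A, mult = (\<lambda>x y. f (g x \<otimes>\<^bsub>A\<^esub> g y)), one = f \<one>\<^bsub>A\<^esub>, zero = f \<zero>\<^bsub>A\<^esub>,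
      add = (\<lambda>x y. f (g x \<oplus>\<^bsub>A\<^esub> g y)), scale = (\<lambda>c x. f (scale A c (g x))),
      star = (\<lambda>x. f (star A (g x))), cnorm = (\<lambda>x. cnorm A (g x))\<rparr>)"

context cstar_algebra
begin

context
  fixes f :: "'a \<Rightarrow> 'b"
  assumes inj: "inj_on f (carrier A)"
begin

lemma transport_simps:
  "carrier (transport A f) = f ` carrier A"
  "\<zero>\<^bsub>transport A f\<^esub> = f \<zero>"
  "\<lbrakk>x \<in> carrier A; y \<in> carrier A\<rbrakk> \<Longrightarrow> f x \<otimes>\<^bsub>transport A f\<^esub> f y = f (x \<otimes> y)"
  "\<lbrakk>x \<in> carrier A; y \<in> carrier A\<rbrakk> \<Longrightarrow> f x \<oplus>\<^bsub>transport A f\<^esub> f y = f (x \<oplus> y)"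
  "x \<in> carrier A \<Longrightarrow> scale (transport A f) c (f x) = f (scale A c x)"
  "x \<in> carrier A \<Longrightarrow> star (transport A f) (f x) = f (star A x)"
  "x \<in> carrier A \<Longrightarrow> cnorm (transport A f) (f x) = cnorm A x"
  using inj by (auto simp: transport_def Let_def)

lemma transport_eq_iff: "\<lbrakk>x \<in> carrier A; y \<in> carrier A\<rbrakk> \<Longrightarrow> f x = f y \<longleftrightarrow> x = y"
  using inj by (auto dest: inj_onD)

lemma abelian_group_transport: "abelian_group (transport A f)"
proof (rule abelian_groupI)
  fix x assume "x \<in> carrier (transport A f)"
  then obtain a where a: "a \<in> carrier A" "x = f a" by (auto simp: transport_simps)
  then show "\<exists>y\<in>carrier (transport A f). y \<oplus>\<^bsub>transport A f\<^esub> x = \<zero>\<^bsub>transport A f\<^esub>"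
    by (intro bexI[of _ "f (\<ominus> a)"]) (auto simp: transport_simps l_neg)
qed (auto simp: transport_simps a_ac)

lemma transport_minus:
  assumes "x \<in> carrier A" "y \<in> carrier A"
  shows "f x \<ominus>\<^bsub>transport A f\<^esub> f y = f (x \<ominus> y)"
proof -
  interpret T: abelian_group "transport A f" by (rule abelian_group_transport)
  have "\<ominus>\<^bsub>transport A f\<^esub> f y = f (\<ominus> y)"
    using assms by (intro T.minus_equality) (auto simp: transport_simps l_neg)
  then show ?thesis
    using assms by (simp add: a_minus_def transport_simps)
qed

lemma cstar_algebra_transport: "cstar_algebra (transport A f)"
proof (intro cstar_algebra.intro abelian_group_transport cstar_algebra_axioms.intro)
  let ?T = "transport A f"
  fix X assume X: "\<And>n. X n \<in> carrier ?T" and Cauchy: "cstar_Cauchy ?T X"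
  then have "\<forall>n. \<exists>a. a \<in> carrier A \<and> X n = f a" by (auto simp: transport_simps)
  then obtain Y where Y: "\<And>n. Y n \<in> carrier A" "\<And>n. X n = f (Y n)" by metis
  have "cstar_Cauchy A Y"
    using Cauchy Y(1) by (simp add: cstar_Cauchy_def Y(2) transport_minus transport_simps)
  then obtain y where "y \<in> carrier A" "cstar_tendsto A Y y"
    using complete Y(1) by blast
  then have "cstar_tendsto ?T X (f y)"
    using Y(1) by (simp add: cstar_tendsto_def Y(2) transport_minus transport_simps)
  then show "\<exists>x\<in>carrier ?T. cstar_tendsto ?T X x"
    using \<open>y \<in> carrier A\<close> by (auto simp: transport_simps)
qed (auto simp: transport_simps transport_eq_iff mult_assoc distrib_left distrib_right scale_add_left
    scale_add_right scale_scale mult_scale_left mult_scale_right star_add star_scale star_mult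
    norm_eq_0_iff norm_triangle norm_scale norm_mult cstar_identity)

lemma bicovariant_rep_transport:
  assumes "bicovariant_rep A S"
  shows "bicovariant_rep (transport A f) (f \<circ> S)"
proof -
  interpret bicovariant_representation A S
    using assms by unfold_locales
  have S: "S \<mu> \<in> carrier A" if "\<mu> \<in> \<F>\<^sub>\<infinity>\<^sup>+" for \<mu>
    using that s_closed by (auto simp: free_semigroup_inf_eq s_def)
  have r: "range_proj (transport A f) (f \<circ> S) \<mu> = f (range_proj A S \<mu>)"
    "initial_proj (transport A f) (f \<circ> S) \<mu> = f (initial_proj A S \<mu>)" if "\<mu> \<in> \<F>\<^sub>\<infinity>\<^sup>+" for \<mu>
    using S[OF that] by (auto simp: range_proj_def initial_proj_def transport_simps)
  have rc: "range_proj A S \<mu> \<in> carrier A" "initial_proj A S \<mu> \<in> carrier A" if "\<mu> \<in> \<F>\<^sub>\<infinity>\<^sup>+" for \<mu>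
    using S[OF that] by (auto simp: range_proj_def initial_proj_def)
  have "\<mu> \<otimes>\<^bsub>\<F>\<^sub>\<infinity>\<^esub> \<nu> \<in> \<F>\<^sub>\<infinity>\<^sup>+" if "\<mu> \<in> \<F>\<^sub>\<infinity>\<^sup>+" "\<nu> \<in> \<F>\<^sub>\<infinity>\<^sup>+" for \<mu> \<nu>
    using that by (rule free_semigroup_inf.mult)
  then have "partial_isometric_rep (transport A f) (f \<circ> S)"
    using assms S unfolding bicovariant_rep_def partial_isometric_rep_def partial_isometry_def
    by (auto simp: transport_simps)
  moreover have "f (case join_l \<mu> \<nu> of Some \<kappa> \<Rightarrow> range_proj A S \<kappa> | None \<Rightarrow> \<zero>) =
      (case join_l \<mu> \<nu> of Some \<kappa> \<Rightarrow> range_proj (transport A f) (f \<circ> S) \<kappa> | None \<Rightarrow> \<zero>\<^bsub>transport A f\<^esub>)"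
    "f (case join_r \<mu> \<nu> of Some \<kappa> \<Rightarrow> initial_proj A S \<kappa> | None \<Rightarrow> \<zero>) =
      (case join_r \<mu> \<nu> of Some \<kappa> \<Rightarrow> initial_proj (transport A f) (f \<circ> S) \<kappa> | None \<Rightarrow> \<zero>\<^bsub>transport A f\<^esub>)"
    if "\<mu> \<in> \<F>\<^sub>\<infinity>\<^sup>+" "\<nu> \<in> \<F>\<^sub>\<infinity>\<^sup>+" for \<mu> \<nu>
    using that by (auto simp: free_semigroup_inf_eq join_l_pos_word join_r_pos_word r transport_simps)
  ultimately show ?thesis
    using assms unfolding bicovariant_rep_def
    by (auto simp: r rc transport_simps)
qed

end

end

section \<open>The compression of the shift representation to a finite word\<close>

text \<open>The index \<open>i\<close> stands for the cut of \<open>m\<close> into \<open>take i m\<close> and \<open>drop i m\<close>.\<close>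

definition word_matrix :: "nat list \<Rightarrow> nat list \<Rightarrow> matrix" where
  "word_matrix m \<nu> i j =
     (if i \<le> length m \<and> j = i + length \<nu> \<and> prefix \<nu> (drop i m) then 1 else 0)"

definition diag :: "nat set \<Rightarrow> matrix" where
  "diag D i j = (if i = j \<and> i \<in> D then 1 else 0)"

definition occ_from :: "nat list \<Rightarrow> nat list \<Rightarrow> nat set" where
  "occ_from m \<nu> = {i. i \<le> length m \<and> prefix \<nu> (drop i m)}"

definition occ_to :: "nat list \<Rightarrow> nat list \<Rightarrow> nat set" where
  "occ_to m \<nu> = {j. j \<le> length m \<and> suffix \<nu> (take j m)}"

definition word_rep :: "nat list \<Rightarrow> word \<Rightarrow> matrix" where
  "word_rep m w = word_matrix m (map fst w)"

lemma word_rep_pos_word: "word_rep m (pos_word xs) = word_matrix m xs"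
  by (simp add: word_rep_def pos_word_def comp_def)

lemma prefix_drop_length: "prefix \<nu> (drop i m) \<Longrightarrow> i \<le> length m \<Longrightarrow> i + length \<nu> \<le> length m"
  using prefix_length_le by fastforce

lemma prefix_append_drop:
  "prefix (\<nu> @ \<nu>') (drop i m) \<longleftrightarrow> prefix \<nu> (drop i m) \<and> prefix \<nu>' (drop (i + length \<nu>) m)"
proof (cases "prefix \<nu> (drop i m)")
  case True
  then obtain r where r: "drop i m = \<nu> @ r" by (auto simp: prefix_def)
  have "drop (i + length \<nu>) m = drop (length \<nu>) (drop i m)" by (simp add: add.commute)
  then show ?thesis by (simp add: r)
next
  case False
  then show ?thesis using append_prefixD by blast
qed

lemma occ_to_iff:
  "j \<in> occ_to m \<nu> \<longleftrightarrow> (\<exists>i. i \<le> length m \<and> j = i + length \<nu> \<and> prefix \<nu> (drop i m))"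
proof
  assume "j \<in> occ_to m \<nu>"
  then obtain a where j: "j \<le> length m" and a: "take j m = a @ \<nu>"
    by (auto simp: occ_to_def suffix_def)
  then have len: "j = length a + length \<nu>"
    by (metis length_append length_take min.absorb2)
  have "m = a @ \<nu> @ drop j m"
    using a append_take_drop_id[of j m] by simp
  then have "drop (length a) m = \<nu> @ drop j m"
    by (metis append_eq_conv_conj)
  then show "\<exists>i. i \<le> length m \<and> j = i + length \<nu> \<and> prefix \<nu> (drop i m)"
    using len j by (intro exI[of _ "length a"]) auto
next
  assume "\<exists>i. i \<le> length m \<and> j = i + length \<nu> \<and> prefix \<nu> (drop i m)"
  then obtain i where i: "i \<le> length m" "j = i + length \<nu>" "prefix \<nu> (drop i m)" by blast
  then have "take j m = take i m @ \<nu>"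
    by (auto simp: take_add prefix_def)
  then show "j \<in> occ_to m \<nu>"
    using i prefix_drop_length[OF i(3,1)] by (auto simp: occ_to_def suffix_def)
qed

lemma occ_subset: "occ_from m \<nu> \<subseteq> {..length m}" "occ_to m \<nu> \<subseteq> {..length m}"
  by (auto simp: occ_from_def occ_to_def)

lemma word_matrix_closed: "word_matrix m \<nu> \<in> carrier (matrix_cstar (length m))"
  using prefix_drop_length by (auto simp: matrix_cstar_def word_matrix_def)

lemma word_matrix_mult: "word_matrix m \<nu> \<otimes>\<^bsub>matrix_cstar (length m)\<^esub> word_matrix m \<nu>' = word_matrix m (\<nu> @ \<nu>')"
proof (intro ext)
  fix i j
  have "(\<Sum>k\<le>length m. word_matrix m \<nu> i k * word_matrix m \<nu>' k j) =
      (\<Sum>k\<le>length m. if k = i + length \<nu> then word_matrix m (\<nu> @ \<nu>') i j else 0)"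
    by (intro sum.cong) (auto simp: word_matrix_def prefix_append_drop)
  also have "\<dots> = word_matrix m (\<nu> @ \<nu>') i j"
    using prefix_drop_length[of \<nu> i m] by (auto simp: word_matrix_def prefix_append_drop)
  finally show "(word_matrix m \<nu> \<otimes>\<^bsub>matrix_cstar (length m)\<^esub> word_matrix m \<nu>') i j = word_matrix m (\<nu> @ \<nu>') i j"
    by (simp add: matrix_cstar_def)
qed

lemma range_word_matrix: "word_matrix m \<nu> \<otimes>\<^bsub>matrix_cstar (length m)\<^esub> star (matrix_cstar (length m)) (word_matrix m \<nu>) = diag (occ_from m \<nu>)"
proof (intro ext)
  fix i j
  have "(\<Sum>k\<le>length m. word_matrix m \<nu> i k * cnj (word_matrix m \<nu> j k)) =
      (\<Sum>k\<le>length m. if k = i + length \<nu> then diag (occ_from m \<nu>) i j else 0)"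
    by (intro sum.cong) (auto simp: word_matrix_def diag_def occ_from_def)
  also have "\<dots> = diag (occ_from m \<nu>) i j"
    using prefix_drop_length[of \<nu> i m] by (auto simp: diag_def occ_from_def)
  finally show "(word_matrix m \<nu> \<otimes>\<^bsub>matrix_cstar (length m)\<^esub> star (matrix_cstar (length m)) (word_matrix m \<nu>)) i j = diag (occ_from m \<nu>) i j"
    by (simp add: matrix_cstar_def)
qed

lemma initial_word_matrix: "star (matrix_cstar (length m)) (word_matrix m \<nu>) \<otimes>\<^bsub>matrix_cstar (length m)\<^esub> word_matrix m \<nu> = diag (occ_to m \<nu>)"
proof (intro ext)
  fix i j
  have "(\<Sum>k\<le>length m. cnj (word_matrix m \<nu> k i) * word_matrix m \<nu> k j) =
      (\<Sum>k\<le>length m. if k + length \<nu> = i then diag (occ_to m \<nu>) i j else 0)"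
    by (intro sum.cong) (auto simp: word_matrix_def diag_def occ_to_iff)
  \<comment> \<open>Truncated subtraction is harmless: the diagonal entry is zero unless an
    occurrence of \<open>\<nu>\<close> ends at \<open>i\<close>, which forces
    \<open>length \<nu> \<le> i\<close>.\<close>
  also have "\<dots> = (\<Sum>k\<le>length m. if k = i - length \<nu> then diag (occ_to m \<nu>) i j else 0)"
    by (intro sum.cong) (auto simp: diag_def occ_to_iff)
  also have "\<dots> = diag (occ_to m \<nu>) i j"
    by (auto simp: diag_def occ_to_iff)
  finally show "(star (matrix_cstar (length m)) (word_matrix m \<nu>) \<otimes>\<^bsub>matrix_cstar (length m)\<^esub> word_matrix m \<nu>) i j = diag (occ_to m \<nu>) i j"
    by (simp add: matrix_cstar_def)
qed

lemma diag_mult: assumes "D \<subseteq> {..length m}" shows "diag D \<otimes>\<^bsub>matrix_cstar (length m)\<^esub> M = (\<lambda>i j. if i \<in> D then M i j else 0)"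
proof (intro ext)
  fix i j
  have "(\<Sum>k\<le>length m. diag D i k * M k j) = (\<Sum>k\<le>length m. if k = i then (if i \<in> D then M i j else 0) else 0)"
    by (intro sum.cong) (auto simp: diag_def)
  also have "\<dots> = (if i \<in> D then M i j else 0)"
    using assms by auto
  finally show "(diag D \<otimes>\<^bsub>matrix_cstar (length m)\<^esub> M) i j = (if i \<in> D then M i j else 0)"
    by (simp add: matrix_cstar_def)
qed

lemma diag_mult_diag: "D \<subseteq> {..length m} \<Longrightarrow> diag D \<otimes>\<^bsub>matrix_cstar (length m)\<^esub> diag D' = diag (D \<inter> D')"
  by (simp add: diag_mult) (auto simp: fun_eq_iff diag_def)

text \<open>The range and initial projections are the coordinate projections onto the positions
  where occurrences of \<open>\<nu>\<close> in \<open>m\<close> start and end. Two words can start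
  at one position only if one is a prefix of the other, and end at one position only if one is a
  suffix of the other.\<close>

lemma bicovariant_word_rep: "bicovariant_rep (matrix_cstar (length m)) (word_rep m)"
proof -
  have "word_matrix m \<nu> \<otimes>\<^bsub>matrix_cstar (length m)\<^esub> star (matrix_cstar (length m)) (word_matrix m \<nu>) \<otimes>\<^bsub>matrix_cstar (length m)\<^esub> word_matrix m \<nu> = word_matrix m \<nu>" for \<nu>
    unfolding range_word_matrix diag_mult[OF occ_subset(1)]
    by (intro ext) (auto simp: word_matrix_def occ_from_def)
  then have "partial_isometric_rep (matrix_cstar (length m)) (word_rep m)"
    by (auto simp: partial_isometric_rep_def partial_isometry_def free_semigroup_inf_eq mult_pos_word
        word_rep_pos_word word_matrix_closed word_matrix_mult)
  moreover have "diag {} = \<zero>\<^bsub>matrix_cstar (length m)\<^esub>"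
    by (auto simp: fun_eq_iff diag_def matrix_cstar_def)
  moreover have "occ_from m \<mu> \<inter> occ_from m \<nu> =
      (if prefix \<mu> \<nu> then occ_from m \<nu> else if prefix \<nu> \<mu> then occ_from m \<mu> else {})" for \<mu> \<nu>
    by (auto simp: occ_from_def intro: prefix_order.trans dest: prefix_same_cases)
  moreover have "occ_to m \<mu> \<inter> occ_to m \<nu> =
      (if suffix \<mu> \<nu> then occ_to m \<nu> else if suffix \<nu> \<mu> then occ_to m \<mu> else {})" for \<mu> \<nu>
    by (auto simp: occ_to_def intro: suffix_order.trans dest: suffix_same_cases)
  ultimately show ?thesis
    by (auto simp: bicovariant_rep_def free_semigroup_inf_eq range_proj_def initial_proj_def
        word_rep_pos_word range_word_matrix initial_word_matrix diag_mult_diag[OF occ_subset(1)]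
        diag_mult_diag[OF occ_subset(2)] join_l_pos_word join_r_pos_word)
qed

lemma word_rep_nonzero: "word_rep m (pos_word m) \<noteq> \<zero>\<^bsub>matrix_cstar (length m)\<^esub>"
proof
  assume "word_rep m (pos_word m) = \<zero>\<^bsub>matrix_cstar (length m)\<^esub>"
  \<comment> \<open>The word \<open>m\<close> carries the last cut of \<open>m\<close> to the first
    one.\<close>
  then have "word_matrix m m 0 (length m) = 0"
    by (simp add: word_rep_pos_word matrix_cstar_def)
  then show False by (simp add: word_matrix_def)
qed

text \<open>A matrix has countably many real and imaginary parts, each determined by the rationals
  below it; all these Dedekind cuts together are coded as one set of natural numbers.\<close>

lemma matrix_lepoll_real: "(UNIV :: matrix set) \<lesssim> (UNIV :: real set)"
proof -
  define cut :: "matrix \<Rightarrow> nat set" where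
    "cut M = to_nat ` {(i, j, b, q :: rat). real_of_rat q < (if b then Re (M i j) else Im (M i j))}" for M
  have "inj cut"
  proof (rule injI)
    fix M N assume "cut M = cut N"
    then have eq: "{(i, j, b, q :: rat). real_of_rat q < (if b then Re (M i j) else Im (M i j))} =
        {(i, j, b, q :: rat). real_of_rat q < (if b then Re (N i j) else Im (N i j))}"
      unfolding cut_def by (simp add: inj_image_eq_iff)
    have re: "real_of_rat q < Re (M i j) \<longleftrightarrow> real_of_rat q < Re (N i j)" for i j q
      using arg_cong[OF eq, of "\<lambda>S. (i, j, True, q) \<in> S"] by simp
    have im: "real_of_rat q < Im (M i j) \<longleftrightarrow> real_of_rat q < Im (N i j)" for i j q
      using arg_cong[OF eq, of "\<lambda>S. (i, j, False, q) \<in> S"] by simp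
    have dense: "x = y" if "\<And>q. real_of_rat q < x \<longleftrightarrow> real_of_rat q < y" for x y :: real
      using that of_rat_dense by (metis linorder_neqE order_less_asym)
    show "M = N"
      using dense re im by (intro ext complex_eqI) blast+
  qed
  then have "(UNIV :: matrix set) \<lesssim> (UNIV :: nat set set)"
    unfolding lepoll_def by blast
  then show ?thesis
    using nat_sets_eqpoll_reals lepoll_trans1 lepoll_trans2 by blast
qed

section \<open>The characterization of universal representations\<close>

theorem theorem9p9:
  fixes A :: "'a cstar" and S :: "word \<Rightarrow> 'a"
  assumes "(UNIV :: real set) \<lesssim> (UNIV :: 'b set)"
    and "cstar_algebra A"
    and "bicovariant_rep A S"
  shows "universal_rep TYPE('b) A S \<longleftrightarrow> (\<forall>\<mu>\<in>\<F>\<^sub>\<infinity>\<^sup>+. S \<mu> \<noteq> \<zero>\<^bsub>A\<^esub>)"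
proof
  assume univ: "universal_rep TYPE('b) A S"
  show "\<forall>\<mu>\<in>\<F>\<^sub>\<infinity>\<^sup>+. S \<mu> \<noteq> \<zero>\<^bsub>A\<^esub>"
  proof (intro ballI notI)
    fix \<mu> assume "\<mu> \<in> \<F>\<^sub>\<infinity>\<^sup>+" and zero: "S \<mu> = \<zero>\<^bsub>A\<^esub>"
    then obtain m where \<mu>: "\<mu> = pos_word m" by (auto simp: free_semigroup_inf_eq)
    \<comment> \<open>The test target is the matrix representation on the cuts of \<open>m\<close>
      itself, which does not vanish at \<open>m\<close>.\<close>
    have "(UNIV :: matrix set) \<lesssim> (UNIV :: 'b set)"
      using matrix_lepoll_real assms(1) lepoll_trans by blast
    then obtain f :: "matrix \<Rightarrow> 'b" where f: "inj f" by (auto simp: lepoll_def)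
    interpret M: cstar_algebra "matrix_cstar (length m)" by (rule cstar_algebra_matrix)
    have inj: "inj_on f (carrier (matrix_cstar (length m)))"
      using f by (rule inj_on_subset) simp
    let ?B = "transport (matrix_cstar (length m)) f" and ?W = "f \<circ> word_rep m"
    interpret B: cstar_algebra ?B by (rule M.cstar_algebra_transport[OF inj])
    have "bicovariant_rep ?B ?W"
      by (rule M.bicovariant_rep_transport[OF inj bicovariant_word_rep])
    then obtain \<phi> where \<phi>: "cstar_hom A (cstar_generated A (S ` \<F>\<^sub>\<infinity>\<^sup>+)) ?B \<phi>"
      and \<phi>S: "\<And>\<mu>. \<mu> \<in> \<F>\<^sub>\<infinity>\<^sup>+ \<Longrightarrow> \<phi> (S \<mu>) = ?W \<mu>"
      using univ B.cstar_algebra_axioms unfolding universal_rep_def by blast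
    interpret A: cstar_algebra A by fact
    \<comment> \<open>Preservation of zero is not part of \<open>cstar_hom\<close>; it follows from
      compatibility with scaling by 0.\<close>
    have "\<zero>\<^bsub>A\<^esub> \<in> cstar_generated A (S ` \<F>\<^sub>\<infinity>\<^sup>+)"
      by (auto simp: cstar_generated_def cstar_subalgebra_def)
    then have "\<phi> (scale A 0 \<zero>\<^bsub>A\<^esub>) = scale ?B 0 (\<phi> \<zero>\<^bsub>A\<^esub>)" "\<phi> \<zero>\<^bsub>A\<^esub> \<in> carrier ?B"
      using \<phi> unfolding cstar_hom_def by blast+
    then have "\<phi> \<zero>\<^bsub>A\<^esub> = \<zero>\<^bsub>?B\<^esub>" by simp
    then have "f (word_rep m (pos_word m)) = f \<zero>\<^bsub>matrix_cstar (length m)\<^esub>"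
      using \<phi>S[of \<mu>] zero by (simp add: \<mu> M.transport_simps(2)[OF inj])
    then show False using word_rep_nonzero f by (auto dest: injD)
  qed
next
  assume nonzero: "\<forall>\<mu>\<in>\<F>\<^sub>\<infinity>\<^sup>+. S \<mu> \<noteq> \<zero>\<^bsub>A\<^esub>"
  show "universal_rep TYPE('b) A S"
    unfolding universal_rep_def
  proof (intro allI impI)
    fix B :: "'b cstar" and W
    assume B: "cstar_algebra B" "bicovariant_rep B W"
    interpret A: bicovariant_representation A S
      using assms(2,3) by (intro bicovariant_representation.intro bicovariant_representation_axioms.intro)
    interpret B: bicovariant_representation B W
      using B by (intro bicovariant_representation.intro bicovariant_representation_axioms.intro)
    interpret two_bicovariant_representations A S B W
      by unfold_locales (use nonzero in \<open>simp add: A.s_def\<close>)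
    show "\<exists>\<phi>. cstar_hom A (cstar_generated A (S ` \<F>\<^sub>\<infinity>\<^sup>+)) B \<phi> \<and> (\<forall>\<mu>\<in>\<F>\<^sub>\<infinity>\<^sup>+. \<phi> (S \<mu>) = W \<mu>)"
      by (rule hom_ex)
  qed
qed


end
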